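(* Let $N\ge 1$ be an integer, let $f,g\in S_0(\mathbb{R})$, and let $\mathsf{f}_N=\mathbf{P}_N f\in\mathbb{C}^N$ and $\mathsf{g}_N=\mathbf{P}_N g\in\mathbb{C}^N$. Then, for all $k,l\in\{0,\dots,N-1\}$, $$\mathbf{V}_g(\mathbf{\Sigma}_N f)\left(\frac{k}{N},l\right)=N^{-1}\cdot \mathbf{V}_{\mathsf{g}_N}\mathsf{f}_N[k,l],$$ where the left-hand side is the short-time Fourier transform of the distribution $\mathbf{\Sigma}_N f\in S_0'(\mathbb{R})$ and the right-hand side is the discrete Gabor transform on $\mathbb{C}^N$.
   Context: For $x,\xi\in\mathbb{R}$ let $\mathbf{T}_x f(t)=f(t-x)$, $\mathbf{M}_\xi f(t)=e^{2\pi i\xi t}f(t)$ and $\pi(x,\xi)=\mathbf{M}_\xi\mathbf{T}_x$. For $f,g\in L^2(\mathbb{R})$ the short-time Fourier transform (STFT) is $\mathbf{V}_g f(x,\xi)=\langle f,\pi(x,\xi)g\rangle=\int_{\mathbb{R}} f(t)\overline{g(t-x)}e^{-2\pi i\xi t}\,dt$. With $h_0(t)=e^{-\pi t^2}$, the Feichtinger algebra is $S_0(\mathbb{R})=\{f\in L^2(\mathbb{R}):\mathbf{V}_{h_0}f\in L^1(\mathbb{R}^2)\}$ with norm $\|f\|_{S_0}=\|\mathbf{V}_{h_0}f\|_{L^1(\mathbb{R}^2)}$; its dual is $S_0'(\mathbb{R})$. The duality pairing $\langle\cdot,\cdot\rangle_{S_0'\times S_0}$ is linear in the first and antilinear in the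 second argument, extending the $L^2$ inner product (so $\langle\delta_t,g\rangle=\overline{g(t)}$). For $\varphi\in S_0'(\mathbb{R})$ and $g\in S_0(\mathbb{R})$, the STFT is $\mathbf{V}_g\varphi(x,\xi)=\langle\varphi,\pi(x,\xi)g\rangle_{S_0'\times S_0}$. The double periodization operator is $\mathbf{\Sigma}_N f=\sum_{k_1,k_2\in\mathbb{Z}}\mathbf{M}_{Nk_2}\mathbf{T}_{k_1}f$ for $f\in S_0(\mathbb{R})$, the series converging unconditionally in the weak-$*$ sense in $S_0'(\mathbb{R})$. The operator $\mathbf{P}_N:S_0(\mathbb{R})\to\mathbb{C}^N$ is $\mathbf{P}_N f=\big(\sum_{j\in\mathbb{Z}}f(n/N-j)\big)_{n=0}^{N-1}$. The discrete Gabor transform on $\mathbb{C}^N$ is $\mathbf{V}_{\mathsf{g}}\mathsf{f}[k,l]=\sum_{m=0}^{N-1}\mathsf{f}[m]\,\overline{\mathsf{g}[m-k]}\,e^{-2\pi i lm/N}$ for $\mathsf{f},\mathsf{g}\in\mathbb{C}^N$, with indices taken modulo $N$. *)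

theory Defs
  imports "HOL-Analysis.Analysis"
begin

definition translation :: "real \<Rightarrow> (real \<Rightarrow> complex) \<Rightarrow> real \<Rightarrow> complex" where
  "translation x f = (\<lambda>t. f (t - x))"

definition modulation :: "real \<Rightarrow> (real \<Rightarrow> complex) \<Rightarrow> real \<Rightarrow> complex" where
  "modulation \<xi> f = (\<lambda>t. cis (2 * pi * \<xi> * t) * f t)"

definition tf_shift :: "real \<Rightarrow> real \<Rightarrow> (real \<Rightarrow> complex) \<Rightarrow> real \<Rightarrow> complex" where
  "tf_shift x \<xi> f = modulation \<xi> (translation x f)"

definition L2 :: "(real \<Rightarrow> complex) set" where
  "L2 = {f \<in> borel_measurable lborel. integrable lborel (\<lambda>t. (cmod (f t))\<^sup>2)}"

definition L2_inner :: "(real \<Rightarrow> complex) \<Rightarrow> (real \<Rightarrow> complex) \<Rightarrow> complex" where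
  "L2_inner f g = (LINT t|lborel. f t * cnj (g t))"

text \<open>The window is the first argument.\<close>

definition stft :: "(real \<Rightarrow> complex) \<Rightarrow> (real \<Rightarrow> complex) \<Rightarrow> real \<Rightarrow> real \<Rightarrow> complex" where
  "stft g f x \<xi> = L2_inner f (tf_shift x \<xi> g)"

definition gauss :: "real \<Rightarrow> complex" where
  "gauss t = of_real (exp (- pi * t\<^sup>2))"

text \<open>
  Every class in the Feichtinger algebra has exactly one continuous representative, and
  point values refer to that representative. The elements of \<open>S0\<close> are these
  continuous representatives, so no quotient by almost-everywhere equality is needed.
\<close>

definition S0 :: "(real \<Rightarrow> complex) set" where
  "S0 = {f \<in> L2. continuous_on UNIV f \<and> integrable lborel (\<lambda>(x, \<xi>). stft gauss f x \<xi>)}"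

definition S0_norm :: "(real \<Rightarrow> complex) \<Rightarrow> real" where
  "S0_norm f = (LINT (x, \<xi>)|lborel. cmod (stft gauss f x \<xi>))"

text \<open>
  Bounded linear functionals on \<open>S0\<close>. Extensionality fixes the irrelevant values
  outside \<open>S0\<close>, so that equality in \<open>S0_dual\<close> is equality of functionals.
\<close>

definition S0_dual :: "((real \<Rightarrow> complex) \<Rightarrow> complex) set" where
  "S0_dual = {\<phi> \<in> extensional S0.
     (\<forall>f\<in>S0. \<forall>g\<in>S0. \<phi> (\<lambda>t. f t + g t) = \<phi> f + \<phi> g) \<and>
     (\<forall>c. \<forall>f\<in>S0. \<phi> (\<lambda>t. c * f t) = c * \<phi> f) \<and>
     (\<exists>C. \<forall>f\<in>S0. cmod (\<phi> f) \<le> C * S0_norm f)}"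

text \<open>
  Functionals are linear, so the sesquilinear pairing conjugates its second argument.
  With the embedding \<open>S0_embed\<close> below, it extends \<open>L2_inner\<close>.
\<close>

definition pairing :: "((real \<Rightarrow> complex) \<Rightarrow> complex) \<Rightarrow> (real \<Rightarrow> complex) \<Rightarrow> complex" where
  "pairing \<phi> g = \<phi> (\<lambda>t. cnj (g t))"

definition S0_embed :: "(real \<Rightarrow> complex) \<Rightarrow> (real \<Rightarrow> complex) \<Rightarrow> complex" where
  "S0_embed f = (\<lambda>h\<in>S0. LINT t|lborel. f t * h t)"

definition stft_dual ::
    "(real \<Rightarrow> complex) \<Rightarrow> ((real \<Rightarrow> complex) \<Rightarrow> complex) \<Rightarrow> real \<Rightarrow> real \<Rightarrow> complex" where
  "stft_dual g \<phi> x \<xi> = pairing \<phi> (tf_shift x \<xi> g)"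

text \<open>
  Unconditional convergence in the weak-* topology: the net of finite partial sums converges
  at every element of \<open>S0\<close>, and the limit functional lies in the dual.
\<close>

definition weak_star_has_sum ::
    "('i \<Rightarrow> (real \<Rightarrow> complex) \<Rightarrow> complex) \<Rightarrow> ((real \<Rightarrow> complex) \<Rightarrow> complex) \<Rightarrow> 'i set \<Rightarrow> bool" where
  "weak_star_has_sum \<Phi> \<phi> I \<longleftrightarrow>
     \<phi> \<in> S0_dual \<and> (\<forall>h\<in>S0. ((\<lambda>i. \<Phi> i h) has_sum \<phi> h) I)"

lemma weak_star_has_sum_unique:
  assumes "weak_star_has_sum \<Phi> \<phi> I" "weak_star_has_sum \<Phi> \<psi> I"
  shows "\<phi> = \<psi>"
proof (rule extensionalityI[where A = S0])
  show "\<phi> \<in> extensional S0" "\<psi> \<in> extensional S0"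
    using assms by (auto simp: weak_star_has_sum_def S0_dual_def)
  show "\<phi> h = \<psi> h" if "h \<in> S0" for h
    using assms that by (auto simp: weak_star_has_sum_def intro: has_sum_unique)
qed

definition double_periodization ::
    "nat \<Rightarrow> (real \<Rightarrow> complex) \<Rightarrow> (real \<Rightarrow> complex) \<Rightarrow> complex" where
  "double_periodization N f =
     (THE \<phi>. weak_star_has_sum
        (\<lambda>(k\<^sub>1 :: int, k\<^sub>2 :: int).
           S0_embed (modulation (of_nat N * of_int k\<^sub>2) (translation (of_int k\<^sub>1) f)))
        \<phi> UNIV)"

text \<open>Vectors of length \<open>N\<close> are functions extensional on \<open>{..<N}\<close>.\<close>

definition sampled_periodization :: "nat \<Rightarrow> (real \<Rightarrow> complex) \<Rightarrow> nat \<Rightarrow> complex" where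
  "sampled_periodization N f =
     (\<lambda>n\<in>{..<N}. \<Sum>\<^sub>\<infinity>j\<in>(UNIV :: int set). f (of_nat n / of_nat N - of_int j))"

text \<open>The window is again the first vector; its index is reduced modulo \<open>N\<close>.\<close>

definition discrete_gabor ::
    "nat \<Rightarrow> (nat \<Rightarrow> complex) \<Rightarrow> (nat \<Rightarrow> complex) \<Rightarrow> nat \<Rightarrow> nat \<Rightarrow> complex" where
  "discrete_gabor N g f k l =
     (\<Sum>m<N. f m * cnj (g (nat ((int m - int k) mod int N)))
              * cis (- 2 * pi * real l * real m / real N))"

end

theory Submission
  imports Defs "HOL-Probability.Characteristic_Functions"
begin

text \<open>
  Paired with a test function \<open>h\<close>, the double periodization of \<open>f\<close> is the sum over \<open>k\<^sub>1\<close> and \<open>k\<^sub>2\<close> of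
  the integrals of \<open>exp (2 \<pi> \<i> N k\<^sub>2 t) f(t - k\<^sub>1) h(t)\<close>. For fixed \<open>k\<^sub>1\<close> the sum over \<open>k\<^sub>2\<close> runs through the
  Fourier transform of the product \<open>f(t - k\<^sub>1) h(t)\<close> at the multiples of \<open>N\<close>, so by Poisson summation it is
  \<open>1 / N\<close> times the sum of \<open>f(n/N - k\<^sub>1) h(n/N)\<close> over all integers \<open>n\<close>. Summing over \<open>k\<^sub>1\<close> and grouping the
  \<open>n\<close> by residues modulo \<open>N\<close> leaves \<open>1 / N\<close> times a sum over \<open>m < N\<close> of the periodizations of \<open>f\<close> and of
  \<open>h\<close> at \<open>m/N\<close> (\<open>double_periodization_sampling\<close>). For the conjugate of the window shifted to \<open>(k/N, l)\<close> the
  modulation is 1-periodic and the translation permutes the grid of step \<open>1/N\<close> modulo 1; what remains is the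
  discrete Gabor transform.

  The analytic content is that all of these sums converge absolutely. It comes from a single formula,
  \<open>S0_reconstruction\<close>: a function in the Feichtinger algebra is an absolutely convergent superposition of
  time-frequency shifted Gaussians, weighted by its short-time Fourier transform. Every estimate is thereby
  reduced to the Gaussian, whose sums over a shifted lattice are bounded uniformly in the shift
  (\<open>gaussian_lattice_sum_bounded\<close>). This gives the summable majorants needed for Poisson summation
  (\<open>S0_wiener_amalgam\<close>) and the summability of all pairings over the time-frequency lattice
  (\<open>lattice_pairing_bounded\<close>), so that the double periodization is indeed the bounded functional given by
  its series (\<open>double_periodization_weak_star\<close>).

  The reconstruction formula is Fourier inversion for the windowed function \<open>f(t) exp (- \<pi> (t - x)\<^sup>2)\<close>,
  which is continuous and integrable and has an integrable transform for almost every \<open>x\<close>. Both Fourier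
  inversion and Poisson summation are convergence of an approximate identity, made of Gaussians in the
  first case and of Fejer kernels in the second (\<open>approximate_identity\<close>).
\<close>

section \<open>The Gaussian and approximate identities\<close>

lemma gaussian_integrable:
  fixes a :: real
  assumes "a > 0"
  shows "integrable lborel (\<lambda>t. exp (- pi * (a * t)\<^sup>2))"
proof -
  have "integrable lborel (\<lambda>x. std_normal_density x * x ^ 0)"
    by (rule integrable_std_normal_moment)
  from integrable_mult_right[OF this, of "sqrt (2 * pi)"]
  have "integrable lborel (\<lambda>x::real. exp (- x\<^sup>2 / 2))"
    by (simp add: std_normal_density_def)
  from lborel_integrable_real_affine[OF this, of "sqrt (2 * pi) * a" 0] assms
  show ?thesis
    by (simp add: power_mult_distrib mult.assoc)
qed

text \<open>
  The characteristic function of the standard normal distribution, rescaled by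
  \<open>sqrt (2 * pi) * a\<close>.
\<close>

lemma gaussian_fourier_transform:
  fixes a \<xi> :: real
  assumes a: "a > 0"
  shows "(LINT t|lborel. cis (2 * pi * \<xi> * t) * of_real (exp (- pi * (a * t)\<^sup>2)))
           = of_real (exp (- pi * (\<xi> / a)\<^sup>2) / a)"
proof -
  define c where "c = sqrt (2 * pi) * a"
  define s where "s = sqrt (2 * pi) * \<xi> / a"
  have c: "c > 0" using a by (simp add: c_def)
  have "of_real (exp (- (s^2) / 2)) = char std_normal_distribution s"
    by (simp add: char_std_normal_distribution)
  also have "\<dots> = (LINT x|lborel. std_normal_density x *\<^sub>R iexp (s * x))"
    unfolding char_def by (subst integral_density) (auto intro!: AE_I2)
  also have "\<dots> = c *\<^sub>R (LINT x|lborel. std_normal_density (c * x) *\<^sub>R iexp (s * (c * x)))"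
    using c by (subst lborel_integral_real_affine[of c _ 0]) auto
  also have "(\<lambda>x. std_normal_density (c * x) *\<^sub>R iexp (s * (c * x))) =
      (\<lambda>t. of_real (1 / sqrt (2 * pi)) * (cis (2 * pi * \<xi> * t) * of_real (exp (- pi * (a * t)\<^sup>2))))"
  proof
    fix t
    have 1: "s * (c * t) = 2 * pi * \<xi> * t"
      using a by (simp add: s_def c_def)
    have 2: "- (c * t)\<^sup>2 / 2 = - pi * (a * t)\<^sup>2"
      using a by (simp add: c_def power_mult_distrib)
    show "std_normal_density (c * t) *\<^sub>R iexp (s * (c * t)) =
      of_real (1 / sqrt (2 * pi)) * (cis (2 * pi * \<xi> * t) * of_real (exp (- pi * (a * t)\<^sup>2)))"
      unfolding std_normal_density_def cis_conv_exp scaleR_conv_of_real 1 2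
      by simp
  qed
  also have "c *\<^sub>R (LINT t|lborel. of_real (1 / sqrt (2 * pi)) * (cis (2 * pi * \<xi> * t) * of_real (exp (- pi * (a * t)\<^sup>2))))
     = of_real a * (LINT t|lborel. cis (2 * pi * \<xi> * t) * of_real (exp (- pi * (a * t)\<^sup>2)))"
    by (simp add: c_def scaleR_conv_of_real)
  finally have "of_real a * (LINT t|lborel. cis (2 * pi * \<xi> * t) * of_real (exp (- pi * (a * t)\<^sup>2)))
     = complex_of_real (exp (- (s^2) / 2))" by simp
  moreover have "s\<^sup>2 / 2 = pi * (\<xi> / a)\<^sup>2"
    by (simp add: s_def power_mult_distrib power_divide)
  ultimately show ?thesis using a by (simp add: field_simps)
qed

lemma gaussian_integral:
  fixes a :: real
  assumes a: "a > 0"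
  shows "(LINT t|lborel. exp (- pi * (a * t)\<^sup>2)) = 1 / a"
proof -
  have "(LINT t|lborel. complex_of_real (exp (- pi * (a * t)\<^sup>2))) = of_real (1 / a)"
    using gaussian_fourier_transform[OF a, of 0] by simp
  then show ?thesis
    unfolding integral_complex_of_real of_real_eq_iff .
qed

text \<open>
  Serves both the Gaussian kernels of Fourier inversion and the Fejer kernels of Poisson
  summation. The tail of the kernels is compared with multiples \<open>c n\<close> of one fixed weight
  \<open>w\<close>, rather than with a constant: since \<open>w\<close> is integrable also against \<open>u\<close>, this controls
  the contribution of \<open>\<bar>t\<bar> \<ge> \<delta>\<close> for functions \<open>u\<close> that are integrable but perhaps unbounded. For the
  Fejer kernels \<open>w\<close> is the indicator of one period.
\<close>

lemma approximate_identity: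
  fixes K :: "nat \<Rightarrow> real \<Rightarrow> real" and u :: "real \<Rightarrow> complex" and w :: "real \<Rightarrow> real"
  assumes K_int: "\<And>n. integrable lborel (K n)" and K_nonneg: "\<And>n t. K n t \<ge> 0"
    and K_one: "\<And>n. (LINT t|lborel. K n t) = 1"
    and Ku: "\<And>n. integrable lborel (\<lambda>t. of_real (K n t) * u t)"
    and w: "integrable lborel w" and wu: "integrable lborel (\<lambda>t. of_real (w t) * u t)"
    and w_nonneg: "\<And>t. w t \<ge> 0"
    and tail: "\<And>\<delta>. \<delta> > 0 \<Longrightarrow> \<exists>c. c \<longlonglongrightarrow> 0 \<and> (\<forall>n t. \<bar>t\<bar> \<ge> \<delta> \<longrightarrow> K n t \<le> c n * w t)"
    and cont: "isCont u 0"
  shows "(\<lambda>n. LINT t|lborel. of_real (K n t) * u t) \<longlonglongrightarrow> u 0"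
proof (rule LIMSEQ_I)
  fix e :: real assume e: "e > 0"
  obtain \<delta> where \<delta>: "\<delta> > 0" "\<And>t. \<bar>t\<bar> < \<delta> \<Longrightarrow> cmod (u t - u 0) < e / 2"
    using cont e unfolding continuous_at_eps_delta dist_norm
    by (metis diff_zero half_gt_zero real_norm_def)
  obtain c where c: "c \<longlonglongrightarrow> 0" and Kc: "\<And>n t. \<bar>t\<bar> \<ge> \<delta> \<Longrightarrow> K n t \<le> c n * w t"
    using tail[OF \<delta>(1)] by blast
  have wu0: "integrable lborel (\<lambda>t. of_real (w t) * (u t - u 0))"
    unfolding right_diff_distrib using w wu by auto
  define B where "B = (LINT t|lborel. cmod (of_real (w t) * (u t - u 0)))"
  have bound: "cmod ((LINT t|lborel. of_real (K n t) * u t) - u 0) \<le> e / 2 + \<bar>c n\<bar> * B" for n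
  proof -
    have Kd: "integrable lborel (\<lambda>t. of_real (K n t) * (u t - u 0))"
      unfolding right_diff_distrib using K_int Ku by auto
    have "(LINT t|lborel. of_real (K n t) * u 0) = u 0"
      using K_int[of n] by (simp add: K_one)
    then have "(LINT t|lborel. of_real (K n t) * u t) - u 0
        = (LINT t|lborel. of_real (K n t) * (u t - u 0))"
      unfolding right_diff_distrib using K_int Ku by (subst Bochner_Integration.integral_diff) auto
    also have "cmod \<dots> \<le> (LINT t|lborel. cmod (of_real (K n t) * (u t - u 0)))"
      by (rule integral_norm_bound)
    also have "\<dots> \<le> (LINT t|lborel. e / 2 * K n t + \<bar>c n\<bar> * cmod (of_real (w t) * (u t - u 0)))"
    proof (rule integral_mono)
      show "integrable lborel (\<lambda>t. e / 2 * K n t + \<bar>c n\<bar> * cmod (of_real (w t) * (u t - u 0)))"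
        using K_int wu0 by (intro Bochner_Integration.integrable_add integrable_mult_right integrable_norm)
      fix t
      show "cmod (of_real (K n t) * (u t - u 0)) \<le> e / 2 * K n t + \<bar>c n\<bar> * cmod (of_real (w t) * (u t - u 0))"
      proof (cases "\<bar>t\<bar> < \<delta>")
        case True
        then have "K n t * cmod (u t - u 0) \<le> K n t * (e / 2)"
          using \<delta>(2)[OF True] K_nonneg by (intro mult_left_mono) auto
        then show ?thesis using K_nonneg[of n t] by (simp add: norm_mult mult.commute add_increasing2)
      next
        case False
        then have "K n t \<le> c n * w t" using Kc by auto
        also have "\<dots> \<le> \<bar>c n\<bar> * w t" using w_nonneg by (intro mult_right_mono) auto
        finally have "K n t * cmod (u t - u 0) \<le> \<bar>c n\<bar> * w t * cmod (u t - u 0)"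
          by (intro mult_right_mono) auto
        moreover have "0 \<le> e / 2 * K n t" using e K_nonneg[of n t] by simp
        ultimately show ?thesis using K_nonneg[of n t] w_nonneg[of t]
          by (simp add: norm_mult mult.assoc)
      qed
    qed (use Kd in auto)
    also have "\<dots> = e / 2 + \<bar>c n\<bar> * B"
      using K_int wu0 by (subst Bochner_Integration.integral_add) (auto simp: K_one B_def)
    finally show ?thesis .
  qed
  have "(\<lambda>n. \<bar>c n\<bar> * B) \<longlonglongrightarrow> 0"
    using tendsto_mult_left_zero[OF tendsto_rabs_zero[OF c]] .
  then obtain M where "\<And>n. n \<ge> M \<Longrightarrow> \<bar>\<bar>c n\<bar> * B\<bar> < e / 2"
    using LIMSEQ_D[of _ 0 "e/2"] e by fastforce
  then show "\<exists>no. \<forall>n\<ge>no. norm ((LINT t|lborel. of_real (K n t) * u t) - u 0) < e"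
    using bound by (intro exI[of _ M]) (smt (verit) field_sum_of_halves)
qed

section \<open>Fourier inversion\<close>

lemma exp_minus_le_inverse: "y > 0 \<Longrightarrow> exp (- y) \<le> 1 / (y::real)"
  using exp_gt_self[of y] unfolding exp_minus inverse_eq_divide by (intro divide_left_mono) auto

text \<open>
  Damping the inverse transform by a wide Gaussian and exchanging integrals gives the
  convolution of \<open>F\<close> with a narrow Gaussian. As the width of the damping grows, one side
  converges by dominated convergence and the other by \<open>approximate_identity\<close>, at every point because
  \<open>F\<close> is continuous.
\<close>

lemma fourier_inversion:
  fixes F :: "real \<Rightarrow> complex"
  assumes cont: "continuous_on UNIV F" and F: "integrable lborel F"
    and T: "integrable lborel (\<lambda>\<xi>. LINT s|lborel. F s * cis (- 2 * pi * \<xi> * s))"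
  shows "(LINT \<xi>|lborel. (LINT s|lborel. F s * cis (- 2 * pi * \<xi> * s)) * cis (2 * pi * \<xi> * t)) = F t"
proof -
  define T where "T = (\<lambda>\<xi>. LINT s|lborel. F s * cis (- 2 * pi * \<xi> * s))"
  define G where "G n \<xi> = exp (- pi * (1 / real (Suc n) * \<xi>)\<^sup>2)" for n \<xi>
  define K where "K n y = real (Suc n) * exp (- pi * (real (Suc n) * y)\<^sup>2)" for n y
  have T_int: "integrable lborel T" using T by (simp add: T_def)
  have G_int: "integrable lborel (G n)" for n
    unfolding G_def by (rule gaussian_integrable) simp
  have [measurable]: "F \<in> borel_measurable borel" "T \<in> borel_measurable borel" "G n \<in> borel_measurable borel" for n
    using F T_int G_int by auto
  have lim1: "(\<lambda>n. LINT \<xi>|lborel. T \<xi> * cis (2 * pi * \<xi> * t) * of_real (G n \<xi>))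
               \<longlonglongrightarrow> (LINT \<xi>|lborel. T \<xi> * cis (2 * pi * \<xi> * t))"
  proof (rule integral_dominated_convergence)
    show "integrable lborel (\<lambda>\<xi>. cmod (T \<xi>))" using T_int by simp
    show "AE \<xi> in lborel. (\<lambda>n. T \<xi> * cis (2 * pi * \<xi> * t) * of_real (G n \<xi>)) \<longlonglongrightarrow> T \<xi> * cis (2 * pi * \<xi> * t)"
    proof (rule AE_I2)
      fix \<xi>
      have "(\<lambda>n. 1 / real (Suc n)) \<longlonglongrightarrow> 0"
        by (rule LIMSEQ_Suc[OF lim_1_over_n])
      then have "(\<lambda>n. G n \<xi>) \<longlonglongrightarrow> exp (- pi * (0 * \<xi>)\<^sup>2)"
        unfolding G_def by (intro tendsto_intros)
      then show "(\<lambda>n. T \<xi> * cis (2 * pi * \<xi> * t) * of_real (G n \<xi>)) \<longlonglongrightarrow> T \<xi> * cis (2 * pi * \<xi> * t)"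
        using tendsto_mult_left[OF tendsto_of_real[where 'a = complex],
            of "\<lambda>n. G n \<xi>" 1 sequentially "T \<xi> * cis (2 * pi * \<xi> * t)"] by simp
    qed
    show "AE \<xi> in lborel. norm (T \<xi> * cis (2 * pi * \<xi> * t) * of_real (G n \<xi>)) \<le> cmod (T \<xi>)" for n
      by (auto simp: norm_mult G_def intro!: mult_left_le)
  qed (unfold cis_conv_exp, measurable)
  have eq: "(LINT \<xi>|lborel. T \<xi> * cis (2 * pi * \<xi> * t) * of_real (G n \<xi>))
        = (LINT y|lborel. of_real (K n y) * F (t + y))" for n
  proof -
    let ?H = "\<lambda>s \<xi>. F s * cis (- 2 * pi * \<xi> * s) * cis (2 * pi * \<xi> * t) * of_real (G n \<xi>)"
    have "integrable (lborel \<Otimes>\<^sub>M lborel) (\<lambda>(s, \<xi>). ?H s \<xi>)"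
    proof (rule lborel_pair.Fubini_integrable)
      show "(\<lambda>(s, \<xi>). ?H s \<xi>) \<in> borel_measurable (lborel \<Otimes>\<^sub>M lborel)"
        unfolding cis_conv_exp by measurable
      have "(LINT \<xi>|lborel. cmod (F s) * \<bar>G n \<xi>\<bar>) = (LINT \<xi>|lborel. \<bar>G n \<xi>\<bar>) * cmod (F s)" for s
        by simp
      then show "integrable lborel (\<lambda>s. LINT \<xi>|lborel. norm (case (s, \<xi>) of (s, \<xi>) \<Rightarrow> ?H s \<xi>))"
        using F by (simp add: norm_mult)
      have "integrable lborel (\<lambda>\<xi>. ?H s \<xi>)" for s
      proof (rule Bochner_Integration.integrable_bound)
        show "integrable lborel (\<lambda>\<xi>. cmod (F s) * G n \<xi>)" using G_int by simp
      qed (unfold cis_conv_exp, measurable, auto simp: norm_mult)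
      then show "AE s in lborel. integrable lborel (\<lambda>\<xi>. case (s, \<xi>) of (s, \<xi>) \<Rightarrow> ?H s \<xi>)"
        by simp
    qed
    note fub = lborel_pair.Fubini_integral[OF this]
    have "(LINT \<xi>|lborel. T \<xi> * cis (2 * pi * \<xi> * t) * of_real (G n \<xi>)) = (LINT \<xi>|lborel. LINT s|lborel. ?H s \<xi>)"
      by (simp add: T_def)
    also have "\<dots> = (LINT s|lborel. LINT \<xi>|lborel. ?H s \<xi>)"
      by (rule fub)
    also have "\<dots> = (LINT s|lborel. F s * of_real (K n (s - t)))"
    proof (rule Bochner_Integration.integral_cong)
      fix s
      have "(LINT \<xi>|lborel. ?H s \<xi>) = (LINT \<xi>|lborel. F s * (cis (2 * pi * (t - s) * \<xi>) * of_real (G n \<xi>)))"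
        by (intro Bochner_Integration.integral_cong refl)
           (simp add: mult.assoc cis_mult algebra_simps)
      also have "\<dots> = F s * (LINT \<xi>|lborel. cis (2 * pi * (t - s) * \<xi>) * of_real (G n \<xi>))"
        by simp
      also have "\<dots> = F s * of_real (K n (s - t))"
        unfolding G_def K_def
        by (subst gaussian_fourier_transform) (auto simp: power_mult_distrib power2_commute)
      finally show "(LINT \<xi>|lborel. ?H s \<xi>) = F s * of_real (K n (s - t))" .
    qed simp
    also have "\<dots> = (LINT y|lborel. of_real (K n y) * F (t + y))"
      by (subst lborel_integral_real_affine[of 1 _ t]) (auto simp: mult.commute)
    finally show ?thesis .
  qed
  have K_nonneg: "K n y \<ge> 0" for n y by (simp add: K_def)
  have K_bound: "K n y \<le> real (Suc n)" for n y by (simp add: K_def mult_left_le)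
  have Ft: "integrable lborel (\<lambda>y. F (t + y))"
    using lborel_integrable_real_affine[OF F, of 1 t] by simp
  have lim2: "(\<lambda>n. LINT y|lborel. of_real (K n y) * F (t + y)) \<longlonglongrightarrow> F (t + 0)"
  proof (rule approximate_identity[where w = "\<lambda>y. exp (- pi * (sqrt (1 / 2) * y)\<^sup>2)"])
    show "integrable lborel (K n)" for n
      unfolding K_def by (intro integrable_mult_right gaussian_integrable) simp
    show "(LINT t|lborel. K n t) = 1" for n
      unfolding K_def by (subst integral_mult_right_zero, subst gaussian_integral) auto
    show "K n y \<ge> 0" for n y by (rule K_nonneg)
    show "integrable lborel (\<lambda>y. of_real (K n y) * F (t + y))" for n
    proof (rule Bochner_Integration.integrable_bound)
      show "integrable lborel (\<lambda>y. real (Suc n) * cmod (F (t + y)))" using Ft by auto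
      show "AE y in lborel. norm (of_real (K n y) * F (t + y)) \<le> norm (real (Suc n) * cmod (F (t + y)))"
        using K_bound[of n] by (intro AE_I2) (simp add: norm_mult K_nonneg mult_right_mono del: of_nat_Suc)
    qed (auto simp: K_def)
    show "integrable lborel (\<lambda>y. exp (- pi * (sqrt (1 / 2) * y)\<^sup>2))"
      by (rule gaussian_integrable) simp
    show "integrable lborel (\<lambda>y. of_real (exp (- pi * (sqrt (1 / 2) * y)\<^sup>2)) * F (t + y))"
    proof (rule Bochner_Integration.integrable_bound)
      show "integrable lborel (\<lambda>y. cmod (F (t + y)))" using Ft by auto
    qed (auto simp: norm_mult intro!: mult_left_le_one_le)
    have "continuous_on UNIV (\<lambda>y. F (t + y))"
      by (intro continuous_on_compose2[OF cont] continuous_intros) auto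
    then show "isCont (\<lambda>y. F (t + y)) 0"
      by (simp add: continuous_on_eq_continuous_at)
    fix \<delta> :: real assume \<delta>: "\<delta> > 0"
    show "\<exists>c. c \<longlonglongrightarrow> 0 \<and> (\<forall>n y. \<bar>y\<bar> \<ge> \<delta> \<longrightarrow> K n y \<le> c n * exp (- pi * (sqrt (1 / 2) * y)\<^sup>2))"
    proof (intro exI conjI allI impI)
      have "(\<lambda>n. (1 / real (Suc n)) * (2 / (pi * \<delta>\<^sup>2))) \<longlonglongrightarrow> 0"
        by (intro tendsto_mult_left_zero LIMSEQ_Suc[OF lim_1_over_n])
      then show "(\<lambda>n. 2 / (pi * \<delta>\<^sup>2 * real (Suc n))) \<longlonglongrightarrow> 0"
        by (simp add: field_simps)
      fix n y assume y: "\<bar>y\<bar> \<ge> \<delta>"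
      define m where "m = real (Suc n)"
      have m: "m \<ge> 1" by (simp add: m_def)
      have y2: "y\<^sup>2 \<ge> \<delta>\<^sup>2" using y \<delta> by (metis abs_le_square_iff abs_of_pos)
      have m2: "m\<^sup>2 \<ge> 1" using m by simp
      \<comment> \<open>Half of the exponent supplies the decay in n, the other half the weight.\<close>
      have "K n y = m * (exp (- (pi * m\<^sup>2 * y\<^sup>2 / 2)) * exp (- (pi * m\<^sup>2 * y\<^sup>2 / 2)))"
        by (simp add: K_def m_def power_mult_distrib flip: exp_add)
      also have "\<dots> \<le> m * (1 / (pi * m\<^sup>2 * \<delta>\<^sup>2 / 2) * exp (- pi * (sqrt (1 / 2) * y)\<^sup>2))"
      proof (intro mult_left_mono mult_mono)
        have "exp (- (pi * m\<^sup>2 * y\<^sup>2 / 2)) \<le> exp (- (pi * m\<^sup>2 * \<delta>\<^sup>2 / 2))"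
          using y2 by (simp add: mult_left_mono)
        also have "\<dots> \<le> 1 / (pi * m\<^sup>2 * \<delta>\<^sup>2 / 2)"
          using m \<delta> by (intro exp_minus_le_inverse) auto
        finally show "exp (- (pi * m\<^sup>2 * y\<^sup>2 / 2)) \<le> 1 / (pi * m\<^sup>2 * \<delta>\<^sup>2 / 2)" .
        have "y\<^sup>2 \<le> m\<^sup>2 * y\<^sup>2" using mult_right_mono[OF m2, of "y\<^sup>2"] by simp
        then show "exp (- (pi * m\<^sup>2 * y\<^sup>2 / 2)) \<le> exp (- pi * (sqrt (1 / 2) * y)\<^sup>2)"
          by (simp add: power_mult_distrib real_sqrt_divide power_divide)
      qed (use m in auto)
      also have "\<dots> = 2 / (pi * \<delta>\<^sup>2 * m) * exp (- pi * (sqrt (1 / 2) * y)\<^sup>2)"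
        using m by (simp add: field_simps power2_eq_square)
      finally show "K n y \<le> 2 / (pi * \<delta>\<^sup>2 * real (Suc n)) * exp (- pi * (sqrt (1 / 2) * y)\<^sup>2)"
        by (simp add: m_def)
    qed
  qed auto
  from LIMSEQ_unique[OF lim1[unfolded eq] lim2] show ?thesis
    by (simp add: T_def)
qed

section \<open>Poisson summation\<close>

lemma cesaro_mean_LIMSEQ:
  fixes s :: "nat \<Rightarrow> 'a :: real_normed_vector"
  assumes s: "s \<longlonglongrightarrow> L"
  shows "(\<lambda>m. (\<Sum>n\<le>m. s n) /\<^sub>R real (Suc m)) \<longlonglongrightarrow> L"
proof (rule LIMSEQ_I)
  fix e :: real assume e: "e > 0"
  obtain N where N: "\<And>n. n \<ge> N \<Longrightarrow> norm (s n - L) < e / 2"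
    using LIMSEQ_D[OF s, of "e / 2"] e by auto
  define C where "C = (\<Sum>n<N. norm (s n - L))"
  obtain M where M: "real M > 2 * C / e" using reals_Archimedean2 by blast
  have "norm ((\<Sum>n\<le>m. s n) /\<^sub>R real (Suc m) - L) < e" if m: "m \<ge> M" for m
  proof -
    have "norm (\<Sum>n\<le>m. s n - L) \<le> (\<Sum>n\<le>m. norm (s n - L))"
      by (rule norm_sum)
    also have "\<dots> \<le> (\<Sum>n\<le>m. (if n < N then norm (s n - L) else 0) + e / 2)"
      using N e by (intro sum_mono) (auto simp: not_less intro: less_imp_le)
    also have "\<dots> = (\<Sum>n\<in>{..m} \<inter> {n. n < N}. norm (s n - L)) + real (Suc m) * (e / 2)"
      by (simp add: sum.distrib sum.inter_restrict)
    also have "(\<Sum>n\<in>{..m} \<inter> {n. n < N}. norm (s n - L)) \<le> C"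
      unfolding C_def by (intro sum_mono2) auto
    also have "C < real (Suc m) * (e / 2)"
    proof -
      have "2 * C / e < real (Suc m)" using M m by linarith
      then show ?thesis using e by (simp add: field_simps)
    qed
    finally have "norm (\<Sum>n\<le>m. s n - L) < real (Suc m) * e" by (simp add: mult.commute)
    moreover have "(\<Sum>n\<le>m. s n - L) = real (Suc m) *\<^sub>R ((\<Sum>n\<le>m. s n) /\<^sub>R real (Suc m) - L)"
      by (simp add: sum_subtractf scaleR_right_diff_distrib sum_constant_scaleR del: of_nat_Suc)
    ultimately show ?thesis by (simp add: del: of_nat_Suc)
  qed
  then show "\<exists>no. \<forall>n\<ge>no. norm ((\<Sum>n\<le>n. s n) /\<^sub>R real (Suc n) - L) < e" by blast
qed

lemma has_sum_int_symmetric_LIMSEQ: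
  fixes a :: "int \<Rightarrow> 'a :: {comm_monoid_add, topological_space}"
  assumes "(a has_sum S) UNIV"
  shows "(\<lambda>n. \<Sum>k\<in>{- int n..int n}. a k) \<longlonglongrightarrow> S"
proof -
  have "filterlim (\<lambda>n. {- int n..int n}) (finite_subsets_at_top UNIV) sequentially"
  proof (subst filterlim_finite_subsets_at_top, intro allI impI)
    fix X :: "int set" assume X: "finite X \<and> X \<subseteq> UNIV"
    define B where "B = (\<Sum>x\<in>X. \<bar>x\<bar>)"
    have B: "\<bar>x\<bar> \<le> B" if "x \<in> X" for x
      unfolding B_def using X that by (intro member_le_sum) auto
    show "\<forall>\<^sub>F n in sequentially. finite {- int n..int n} \<and> X \<subseteq> {- int n..int n} \<and> {- int n..int n} \<subseteq> UNIV"
      using eventually_ge_at_top[of "nat B"]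
      by eventually_elim (use B in force)
  qed
  with assms show ?thesis
    unfolding has_sum_def by (rule filterlim_compose)
qed

text \<open>
  The Fejer kernel as a sum of Dirichlet kernels and as a square. The first form links it to
  partial sums of Fourier series, the second shows that it is nonnegative.
\<close>

lemma sum_dirichlet_kernels:
  fixes t :: real
  shows "(\<Sum>n<m. \<Sum>k\<in>{- int n..int n}. cis (2 * pi * of_int k * t))
           = of_real ((cmod (\<Sum>j<m. cis (2 * pi * real j * t)))\<^sup>2)"
proof (induction m)
  case (Suc m)
  define S where "S = (\<Sum>j<m. cis (2 * pi * real j * t))"
  define z where "z = cis (2 * pi * real m * t)"
  have neg: "S * cnj z = (\<Sum>k\<in>{- int m..<0}. cis (2 * pi * of_int k * t))"
    unfolding S_def z_def sum_distrib_right
    by (rule sum.reindex_bij_witness[of _ "\<lambda>k. nat (k + int m)" "\<lambda>j. int j - int m"])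
       (auto simp: cis_cnj cis_mult algebra_simps)
  have pos: "cnj S * z = (\<Sum>k\<in>{0<..int m}. cis (2 * pi * of_int k * t))"
    unfolding S_def z_def sum_distrib_right cnj_sum
    by (rule sum.reindex_bij_witness[of _ "\<lambda>k. nat (int m - k)" "\<lambda>j. int m - int j"])
       (auto simp: cis_cnj cis_mult algebra_simps)
  have split: "{- int m..int m} = {- int m..<0} \<union> ({0} \<union> {0<..int m})" by auto
  have "(\<Sum>k\<in>{- int m..int m}. cis (2 * pi * of_int k * t)) = S * cnj z + (1 + cnj S * z)"
    unfolding split by (subst sum.union_disjoint) (auto simp: neg pos)
  moreover have "z * cnj z = 1" by (simp add: z_def cis_cnj cis_mult)
  moreover have "of_real ((cmod (S + z))\<^sup>2) = (S + z) * cnj (S + z)"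
    by (rule complex_norm_square)
  moreover have "of_real ((cmod S)\<^sup>2) = S * cnj S"
    by (rule complex_norm_square)
  ultimately show ?case
    using Suc.IH unfolding sum.lessThan_Suc S_def[symmetric] z_def[symmetric]
    by (simp add: algebra_simps)
qed simp

lemma norm_one_minus_cis: "cmod (1 - cis \<theta>) = 2 * \<bar>sin (\<theta> / 2)\<bar>"
proof -
  have "(cmod (1 - cis \<theta>))\<^sup>2 = (1 - cos \<theta>)\<^sup>2 + (sin \<theta>)\<^sup>2"
    by (simp add: cmod_power2)
  also have "\<dots> = 2 - 2 * cos \<theta>"
    using sin_cos_squared_add[of \<theta>] by (simp add: power2_diff)
  also have "\<dots> = (2 * \<bar>sin (\<theta> / 2)\<bar>)\<^sup>2"
    using cos_double_sin[of "\<theta> / 2"] by (simp add: power_mult_distrib)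
  finally show ?thesis by (rule power2_eq_imp_eq) auto
qed

lemma fejer_sum_bound:
  fixes t :: real
  assumes s: "sin (pi * t) \<noteq> 0"
  shows "cmod (\<Sum>j<m. cis (2 * pi * real j * t)) \<le> 1 / \<bar>sin (pi * t)\<bar>"
proof -
  define z where "z = cis (2 * pi * t)"
  have "(\<Sum>j<m. cis (2 * pi * real j * t)) = (\<Sum>j<m. z ^ j)"
    by (simp only: z_def Complex.DeMoivre mult_ac)
  moreover have "(1 - z) * (\<Sum>j<m. z ^ j) = 1 - z ^ m"
    by (simp add: one_diff_power_eq)
  moreover have "cmod (1 - z ^ m) \<le> 2"
    using norm_triangle_ineq4[of 1 "z ^ m"] by (simp add: z_def norm_power)
  moreover have "cmod (1 - z) = 2 * \<bar>sin (pi * t)\<bar>"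
    by (simp add: z_def norm_one_minus_cis)
  ultimately have "2 * \<bar>sin (pi * t)\<bar> * cmod (\<Sum>j<m. cis (2 * pi * real j * t)) \<le> 2"
    by (metis norm_mult)
  then show ?thesis using s by (simp add: field_simps)
qed

text \<open>
  Half-open, so that its integer translates partition the line.
\<close>

abbreviation unit_cell :: "real set" where "unit_cell \<equiv> {- (1/2)..<1/2}"

lemma integral_character_unit_cell:
  fixes k :: int
  shows "integrable lborel (\<lambda>t. indicator unit_cell t *\<^sub>R cis (2 * pi * of_int k * t))"
    and "(LINT t|lborel. indicator unit_cell t *\<^sub>R cis (2 * pi * of_int k * t)) = (if k = 0 then 1 else 0)"
proof -
  show "integrable lborel (\<lambda>t. indicator unit_cell t *\<^sub>R cis (2 * pi * of_int k * t))"
    by (rule Bochner_Integration.integrable_bound[where f = "indicator unit_cell :: real \<Rightarrow> real"])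
       (unfold cis_conv_exp, auto simp: indicator_def)
  have "(LINT t|lborel. indicator unit_cell t *\<^sub>R cis (2 * pi * of_int k * t))
      = (LINT t|lborel. indicator {- (1/2)..1/2} t *\<^sub>R cis (2 * pi * of_int k * t))"
  proof (rule integral_cong_AE)
    show "AE t in lborel. indicator unit_cell t *\<^sub>R cis (2 * pi * of_int k * t)
        = indicator {- (1/2)..1/2} t *\<^sub>R cis (2 * pi * of_int k * t)"
      using AE_lborel_singleton[of "1/2::real"] by eventually_elim (auto simp: indicator_def)
  qed (unfold cis_conv_exp, measurable)
  also have "\<dots> = (if k = 0 then 1 else 0)"
  proof (cases "k = 0")
    case False
    define c where "c = 2 * pi * of_int k"
    have c: "c \<noteq> 0" using False by (simp add: c_def)
    have "(LINT t|lborel. indicator {- (1/2)..1/2} t *\<^sub>R cis (c * t))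
        = cis (c * (1/2)) / (\<i> * c) - cis (c * (- (1/2))) / (\<i> * c)"
    proof (rule integral_FTC_Icc)
      fix x :: real
      show "((\<lambda>t. cis (c * t) / (\<i> * c)) has_vector_derivative cis (c * x)) (at x within {- (1/2)..1/2})"
        unfolding cis_conv_exp of_real_mult
        by (rule has_vector_derivative_real_field[where f = "\<lambda>z. exp (\<i> * (c * z)) / (\<i> * c)"])
           (use c in \<open>auto intro!: derivative_eq_intros simp: field_simps\<close>)
    qed (auto intro!: continuous_intros)
    also have "cis (c * (1/2)) = cis (c * (- (1/2)))"
    proof -
      have "cis (c * (1/2)) = cis (c * (- (1/2)) + 2 * pi * of_int k)" by (simp add: c_def)
      also have "\<dots> = cis (c * (- (1/2)))" unfolding cis_mult[symmetric] by (simp add: cis_multiple_2pi)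
      finally show ?thesis .
    qed
    finally show ?thesis using False by (simp add: c_def)
  qed simp
  finally show "(LINT t|lborel. indicator unit_cell t *\<^sub>R cis (2 * pi * of_int k * t)) = (if k = 0 then 1 else 0)" .
qed

text \<open>
  The Cesaro means of the symmetric partial sums are integrals against the Fejer kernels, so
  they converge to \<open>G 0\<close>; if the series converges, its sum must agree with them.
\<close>

lemma fourier_series_at_zero:
  fixes G :: "real \<Rightarrow> complex"
  assumes G: "integrable lborel (\<lambda>t. indicator unit_cell t *\<^sub>R G t)"
    and cont: "isCont G 0"
    and coeff: "((\<lambda>k::int. LINT t|lborel. indicator unit_cell t *\<^sub>R (G t * cis (2 * pi * of_int k * t))) has_sum S) UNIV"
  shows "S = G 0"
proof -
  define D where "D n t = (\<Sum>k\<in>{- int n..int n}. cis (2 * pi * of_int k * t))" for n t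
  define K where "K m t = indicator unit_cell t * ((cmod (\<Sum>j<Suc m. cis (2 * pi * real j * t)))\<^sup>2 / real (Suc m))" for m t
  have KD: "of_real (K m t) = (\<Sum>n\<le>m. indicator unit_cell t *\<^sub>R D n t) /\<^sub>R real (Suc m)" for m t
    unfolding K_def D_def scaleR_sum_right[symmetric] lessThan_Suc_atMost[symmetric] sum_dirichlet_kernels
    by (simp only: scaleR_conv_of_real divide_inverse of_real_mult of_real_inverse of_real_power mult_ac)
  define u where "u t = indicator unit_cell t *\<^sub>R G t" for t
  have u_int: "integrable lborel u" using G by (simp add: u_def[abs_def])
  have char_int: "integrable lborel (\<lambda>t. indicator unit_cell t *\<^sub>R (G t * cis (2 * pi * of_int k * t)))" for k :: int
  proof (rule Bochner_Integration.integrable_bound[OF G])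
    have "(\<lambda>t. (indicator unit_cell t *\<^sub>R G t) * cis (2 * pi * of_int k * t)) \<in> borel_measurable lborel"
      using G unfolding cis_conv_exp by measurable
    then show "(\<lambda>t. indicator unit_cell t *\<^sub>R (G t * cis (2 * pi * of_int k * t))) \<in> borel_measurable lborel"
      by simp
  qed (auto simp: norm_mult)
  have D_int: "integrable lborel (\<lambda>t. indicator unit_cell t *\<^sub>R D n t)" for n
    unfolding D_def scaleR_sum_right
    by (intro Bochner_Integration.integrable_sum integral_character_unit_cell)
  have D_one: "(LINT t|lborel. indicator unit_cell t *\<^sub>R D n t) = 1" for n
    unfolding D_def scaleR_sum_right
    by (subst Bochner_Integration.integral_sum) (auto simp: integral_character_unit_cell)
  have K_cint: "integrable lborel (\<lambda>t. complex_of_real (K m t))" for m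
    unfolding KD by (intro integrable_scaleR_right Bochner_Integration.integrable_sum D_int)
  have K_int: "integrable lborel (K m)" for m
    using integrable_Re[OF K_cint[of m]] by simp
  have "(LINT t|lborel. complex_of_real (K m t)) = (\<Sum>n\<le>m. 1) /\<^sub>R real (Suc m)" for m
    unfolding KD D_one[symmetric] integral_scaleR_right
    by (subst Bochner_Integration.integral_sum) (simp_all only: D_int D_one)
  then have K_one: "(LINT t|lborel. K m t) = 1" for m
    unfolding integral_complex_of_real by (simp add: scaleR_conv_of_real field_simps flip: of_nat_Suc)
  have DG: "indicator unit_cell t *\<^sub>R (D n t * G t) =
      (\<Sum>k\<in>{- int n..int n}. indicator unit_cell t *\<^sub>R (G t * cis (2 * pi * of_int k * t)))" for n t
    by (simp only: D_def sum_distrib_right scaleR_sum_right mult.commute[of "cis _" "G _"])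
  have Du: "integrable lborel (\<lambda>t. indicator unit_cell t *\<^sub>R (D n t * G t))"
      "(LINT t|lborel. indicator unit_cell t *\<^sub>R (D n t * G t)) =
         (\<Sum>k\<in>{- int n..int n}. LINT t|lborel. indicator unit_cell t *\<^sub>R (G t * cis (2 * pi * of_int k * t)))" for n
    unfolding DG
    by (rule Bochner_Integration.integrable_sum Bochner_Integration.integral_sum, rule char_int)+
  have Ku: "of_real (K m t) * u t = (\<Sum>n\<le>m. indicator unit_cell t *\<^sub>R (D n t * G t)) /\<^sub>R real (Suc m)" for m t
    unfolding KD u_def by (auto simp: indicator_def sum_distrib_right)
  have "(\<lambda>m. LINT t|lborel. of_real (K m t) * u t) \<longlonglongrightarrow> u 0"
  proof (rule approximate_identity[where w = "indicator unit_cell"])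
    show "K m t \<ge> 0" for m t by (simp add: K_def)
    show "integrable lborel (\<lambda>t. complex_of_real (K m t) * u t)" for m
      unfolding Ku by (intro integrable_scaleR_right Bochner_Integration.integrable_sum Du)
    show "integrable lborel (\<lambda>t. of_real (indicator unit_cell t) * u t)"
      using u_int by (rule Bochner_Integration.integrable_bound) (use u_int in \<open>auto simp: norm_mult indicator_def\<close>)
    have "\<forall>\<^sub>F t in nhds (0::real). t \<in> {- (1/2)<..<1/2}"
      by (rule eventually_nhds_in_open) auto
    then have "\<forall>\<^sub>F t in nhds 0. u t = G t"
      by eventually_elim (auto simp: u_def)
    then show "isCont u 0" using cont isCont_cong by blast
    fix \<delta> :: real assume \<delta>: "\<delta> > 0"
    \<comment> \<open>On one period, only distances up to one half occur, where the sine is increasing.\<close>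
    define \<delta>' where "\<delta>' = min \<delta> (1/2)"
    have d': "\<delta>' > 0" "\<delta>' \<le> 1/2" using \<delta> by (auto simp: \<delta>'_def)
    have s0: "sin (pi * \<delta>') > 0"
      using d' by (intro sin_gt_zero) (auto simp: field_simps)
    show "\<exists>c. c \<longlonglongrightarrow> 0 \<and> (\<forall>n t. \<bar>t\<bar> \<ge> \<delta> \<longrightarrow> K n t \<le> c n * indicator unit_cell t)"
    proof (intro exI conjI allI impI)
      show "(\<lambda>n. 1 / real (Suc n) * (1 / (sin (pi * \<delta>'))\<^sup>2)) \<longlonglongrightarrow> 0"
        by (intro tendsto_mult_left_zero LIMSEQ_Suc[OF lim_1_over_n])
      fix n t assume t: "\<bar>t\<bar> \<ge> \<delta>"
      show "K n t \<le> 1 / real (Suc n) * (1 / (sin (pi * \<delta>'))\<^sup>2) * indicator unit_cell t"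
      proof (cases "t \<in> unit_cell")
        case True
        then have t2: "\<bar>t\<bar> \<le> 1/2" by auto
        have "sin (pi * \<delta>') \<le> sin (pi * \<bar>t\<bar>)"
        proof (rule sin_monotone_2pi_le)
          have "0 \<le> pi * \<delta>'" using d' by simp
          then show "- (pi / 2) \<le> pi * \<delta>'" using pi_ge_zero by linarith
          show "pi * \<delta>' \<le> pi * \<bar>t\<bar>" using t by (intro mult_left_mono) (auto simp: \<delta>'_def)
          show "pi * \<bar>t\<bar> \<le> pi / 2" using mult_left_mono[OF t2 pi_ge_zero] by simp
        qed
        moreover have "\<bar>sin (pi * t)\<bar> = \<bar>sin (pi * \<bar>t\<bar>)\<bar>" by (cases "t \<ge> 0") auto
        ultimately have s: "sin (pi * \<delta>') \<le> \<bar>sin (pi * t)\<bar>" by linarith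
        have "cmod (\<Sum>j<Suc n. cis (2 * pi * real j * t)) \<le> 1 / \<bar>sin (pi * t)\<bar>"
          using s s0 by (intro fejer_sum_bound) auto
        also have "\<dots> \<le> 1 / sin (pi * \<delta>')" using s s0 by (intro divide_left_mono) auto
        finally have "(cmod (\<Sum>j<Suc n. cis (2 * pi * real j * t)))\<^sup>2 \<le> (1 / sin (pi * \<delta>'))\<^sup>2"
          by (intro power_mono) auto
        then have "(cmod (\<Sum>j<Suc n. cis (2 * pi * real j * t)))\<^sup>2 / real (Suc n) \<le> (1 / sin (pi * \<delta>'))\<^sup>2 / real (Suc n)"
          by (rule divide_right_mono) simp
        then show ?thesis using True unfolding K_def by (simp add: power_divide mult.commute del: sum.lessThan_Suc)
      qed (simp add: K_def)
    qed
  qed (use K_int K_one in auto)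
  moreover have "(\<lambda>m. LINT t|lborel. of_real (K m t) * u t) \<longlonglongrightarrow> S"
  proof -
    have "(LINT t|lborel. of_real (K m t) * u t) =
        (\<Sum>n\<le>m. \<Sum>k\<in>{- int n..int n}. LINT t|lborel. indicator unit_cell t *\<^sub>R (G t * cis (2 * pi * of_int k * t))) /\<^sub>R real (Suc m)" for m
      unfolding Ku integral_scaleR_right Du(2)[symmetric]
      by (subst Bochner_Integration.integral_sum) (auto intro: Du(1) simp del: of_nat_Suc)
    then show ?thesis
      using cesaro_mean_LIMSEQ[OF has_sum_int_symmetric_LIMSEQ[OF coeff]] by simp
  qed
  ultimately have "u 0 = S" by (rule LIMSEQ_unique)
  then show ?thesis by (simp add: u_def)
qed

text \<open>
  The integrals over the line are the Fourier coefficients of the periodization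
  \<open>G t = (\<Sum>\<^sub>\<infinity>n. F (n + t))\<close>, and both sides are \<open>G 0\<close>. The majorant \<open>M\<close> makes the series for \<open>G\<close>
  uniformly convergent, which gives continuity at \<open>0\<close>.
\<close>

lemma poisson_summation:
  fixes F :: "real \<Rightarrow> complex" and M :: "int \<Rightarrow> real"
  assumes cont: "continuous_on UNIV F" and F: "integrable lborel F"
    and M: "M summable_on UNIV" and bound: "\<And>n t. \<bar>t\<bar> \<le> 1/2 \<Longrightarrow> cmod (F (of_int n + t)) \<le> M n"
    and coeff: "(\<lambda>k::int. LINT t|lborel. F t * cis (2 * pi * of_int k * t)) summable_on UNIV"
  shows "((\<lambda>k::int. LINT t|lborel. F t * cis (2 * pi * of_int k * t)) has_sum (\<Sum>\<^sub>\<infinity>n. F (of_int n))) UNIV"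
proof -
  define I where "I = {- (1/2)..1/2::real}"
  define G where "G t = (\<Sum>\<^sub>\<infinity>n::int. F (of_int n + t))" for t
  have M_nonneg: "M n \<ge> 0" for n
    using order_trans[OF norm_ge_zero bound[of 0 n]] by simp
  have bound_I: "cmod (F (of_int n + t)) \<le> M n" if "t \<in> I" for n t
    using that by (intro bound) (auto simp: I_def abs_if)
  have abs_summable: "(\<lambda>n. cmod (F (of_int n + t))) summable_on UNIV" if "t \<in> I" for t
    by (rule summable_on_comparison_test[OF M]) (use bound_I[OF that] in simp_all)
  have G_has_sum: "((\<lambda>n. F (of_int n + t)) has_sum G t) UNIV" if "t \<in> I" for t
    unfolding G_def by (rule has_sum_infsum[OF abs_summable_summable[OF abs_summable[OF that]]])
  have "uniform_limit I (\<lambda>X t. \<Sum>n\<in>X. F (of_int n + t)) G (finite_subsets_at_top UNIV)"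
    unfolding G_def by (rule Weierstrass_m_test_general[OF _ M]) (rule bound_I)
  moreover have "\<forall>\<^sub>F X in finite_subsets_at_top (UNIV :: int set). continuous_on I (\<lambda>t. \<Sum>n\<in>X. F (of_int n + t))"
    by (intro always_eventually allI continuous_intros continuous_on_compose2[OF cont]) auto
  ultimately have G_cont: "continuous_on I G"
    by (intro uniform_limit_theorem) auto
  have G0: "isCont G 0"
    using G_cont by (rule continuous_on_interior) (simp add: I_def)
  have partial_bound: "cmod (\<Sum>n\<in>X. F (of_int n + t)) \<le> infsum M UNIV" if "t \<in> I" "finite X" for X t
  proof -
    have "cmod (\<Sum>n\<in>X. F (of_int n + t)) \<le> (\<Sum>n\<in>X. M n)"
      by (intro sum_norm_le bound_I that)
    also have "\<dots> \<le> infsum M UNIV" by (intro finite_sum_le_infsum M M_nonneg that) auto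
    finally show ?thesis .
  qed
  have unit_I: "t \<in> unit_cell \<Longrightarrow> t \<in> I" for t by (auto simp: I_def)
  have [measurable]: "F \<in> borel_measurable borel" using F by auto
  have G_meas: "(\<lambda>t. indicator unit_cell t *\<^sub>R G t) \<in> borel_measurable borel"
    by (rule borel_measurable_continuous_on_indicator) (use G_cont unit_I in \<open>auto intro: continuous_on_subset\<close>)
  have ind_int: "integrable lborel (\<lambda>t. indicator unit_cell t * c)" for c :: real
    by (intro integrable_mult_left) auto
  have G_bound: "cmod (G t) \<le> infsum M UNIV" if t: "t \<in> I" for t
    using tendsto_upperbound[OF tendsto_norm[OF G_has_sum[OF t, unfolded has_sum_def]] _ finite_subsets_at_top_neq_bot]
      partial_bound[OF t] eventually_finite_subsets_at_top_weakI by blast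
  have G_int: "integrable lborel (\<lambda>t. indicator unit_cell t *\<^sub>R G t)"
    by (rule Bochner_Integration.integrable_bound[OF ind_int[of "infsum M UNIV"]])
       (use G_meas G_bound unit_I in \<open>auto simp: indicator_def intro: order_trans[OF _ abs_ge_self]\<close>)
  have coeff_eq: "(LINT t|lborel. indicator unit_cell t *\<^sub>R (G t * cis (2 * pi * of_int k * t)))
       = (LINT t|lborel. F t * cis (2 * pi * of_int k * t))" for k :: int
  proof -
    let ?e = "\<lambda>t. cis (2 * pi * of_int k * t)"
    have [measurable]: "?e \<in> borel_measurable borel" unfolding cis_conv_exp by measurable
    \<comment> \<open>The character has an integer frequency, so it does not see the shift between cells.\<close>
    have e_per: "?e (of_int n + t) = ?e t" for n t
    proof -
      have "?e (of_int n + t) = cis (2 * pi * of_int (k * n)) * ?e t"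
        by (simp add: cis_mult algebra_simps)
      then show ?thesis by (simp add: cis_multiple_2pi)
    qed
    have Fe_int: "integrable lborel (\<lambda>t. F t * ?e t)"
      by (rule Bochner_Integration.integrable_bound[OF F]) (auto simp: norm_mult)
    \<comment> \<open>Exactly one integer translate of the unit cell contains a given point.\<close>
    have cell: "indicator unit_cell (t - of_int n) = (if n = \<lfloor>t + 1/2\<rfloor> then 1 else 0 :: real)" for n t
      by (auto simp: indicator_def) linarith+
    define P where "P m = (LINT t|lborel. indicator unit_cell t *\<^sub>R ((\<Sum>n\<in>{- int m..int m}. F (of_int n + t)) * ?e t))" for m
    \<comment> \<open>The integral of the partial periodization over one cell is the integral of F over 2 m + 1 cells; both readings are taken to the limit.\<close>
    have lim1: "P \<longlonglongrightarrow> (LINT t|lborel. indicator unit_cell t *\<^sub>R (G t * ?e t))"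
      unfolding P_def
    proof (rule integral_dominated_convergence)
      have "(\<lambda>t. (indicator unit_cell t *\<^sub>R G t) * ?e t) \<in> borel_measurable lborel"
        using G_meas by measurable
      then show "(\<lambda>t. indicator unit_cell t *\<^sub>R (G t * ?e t)) \<in> borel_measurable lborel" by simp
      show "integrable lborel (\<lambda>t. indicator unit_cell t * infsum M UNIV)" by (rule ind_int)
      show "AE t in lborel. (\<lambda>m. indicator unit_cell t *\<^sub>R ((\<Sum>n\<in>{- int m..int m}. F (of_int n + t)) * ?e t))
          \<longlonglongrightarrow> indicator unit_cell t *\<^sub>R (G t * ?e t)"
        using has_sum_int_symmetric_LIMSEQ[OF G_has_sum] unit_I
        by (intro AE_I2) (auto simp: indicator_def intro!: tendsto_intros)
      show "AE t in lborel. norm (indicator unit_cell t *\<^sub>R ((\<Sum>n\<in>{- int m..int m}. F (of_int n + t)) * ?e t))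
          \<le> indicator unit_cell t * infsum M UNIV" for m
        using partial_bound unit_I by (intro AE_I2) (auto simp: indicator_def norm_mult)
    qed measurable
    have P_eq: "P m = (LINT t|lborel. (\<Sum>n\<in>{- int m..int m}. indicator unit_cell (t - of_int n)) *\<^sub>R (F t * ?e t))" for m
    proof -
      have piece_int: "integrable lborel (\<lambda>t. indicator unit_cell (t - of_int n) *\<^sub>R (F t * ?e t))" for n :: int
        by (rule Bochner_Integration.integrable_bound[OF Fe_int]) (auto simp: indicator_def)
      have piece: "(LINT t|lborel. indicator unit_cell (t - of_int n) *\<^sub>R (F t * ?e t))
          = (LINT t|lborel. indicator unit_cell t *\<^sub>R (F (of_int n + t) * ?e t))"
        and piece_int': "integrable lborel (\<lambda>t. indicator unit_cell t *\<^sub>R (F (of_int n + t) * ?e t))" for n :: int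
        using lborel_integral_real_affine[of 1 "\<lambda>t. indicator unit_cell (t - of_int n) *\<^sub>R (F t * ?e t)" "of_int n"]
          lborel_integrable_real_affine[OF piece_int[of n], of 1 "of_int n"]
        by (simp_all add: e_per)
      have "P m = (\<Sum>n\<in>{- int m..int m}. LINT t|lborel. indicator unit_cell t *\<^sub>R (F (of_int n + t) * ?e t))"
        unfolding P_def sum_distrib_right scaleR_sum_right
        by (rule Bochner_Integration.integral_sum) (rule piece_int')
      also have "\<dots> = (LINT t|lborel. (\<Sum>n\<in>{- int m..int m}. indicator unit_cell (t - of_int n)) *\<^sub>R (F t * ?e t))"
        unfolding piece[symmetric] scaleR_sum_left
        by (rule Bochner_Integration.integral_sum[symmetric]) (rule piece_int)
      finally show ?thesis .
    qed
    have lim2: "P \<longlonglongrightarrow> (LINT t|lborel. F t * ?e t)"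
      unfolding P_eq cell
    proof (rule integral_dominated_convergence)
      show "integrable lborel (\<lambda>t. cmod (F t * ?e t))" using Fe_int by simp
      show "AE t in lborel. (\<lambda>m. (\<Sum>n\<in>{- int m..int m}. if n = \<lfloor>t + 1/2\<rfloor> then 1 else 0) *\<^sub>R (F t * ?e t)) \<longlonglongrightarrow> F t * ?e t"
      proof (rule AE_I2)
        fix t :: real
        have "\<forall>\<^sub>F m in sequentially. (\<Sum>n\<in>{- int m..int m}. if n = \<lfloor>t + 1/2\<rfloor> then 1 else 0) *\<^sub>R (F t * ?e t) = F t * ?e t"
          using eventually_ge_at_top[of "nat \<bar>\<lfloor>t + 1/2\<rfloor>\<bar>"]
          by eventually_elim auto
        then show "(\<lambda>m. (\<Sum>n\<in>{- int m..int m}. if n = \<lfloor>t + 1/2\<rfloor> then 1 else 0) *\<^sub>R (F t * ?e t)) \<longlonglongrightarrow> F t * ?e t"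
          by (rule tendsto_eventually)
      qed
    qed (auto simp: norm_mult)
    show ?thesis by (rule LIMSEQ_unique[OF lim1 lim2])
  qed
  from coeff have hs: "((\<lambda>k::int. LINT t|lborel. F t * cis (2 * pi * of_int k * t)) has_sum
      (\<Sum>\<^sub>\<infinity>k::int. LINT t|lborel. F t * cis (2 * pi * of_int k * t))) UNIV"
    by (rule has_sum_infsum)
  with fourier_series_at_zero[OF G_int G0, unfolded coeff_eq, OF hs]
  show ?thesis by (simp add: G_def)
qed

section \<open>Gaussian synthesis in the Feichtinger algebra\<close>

lemma borel_measurable_fst_snd [measurable (raw)]:
  fixes f :: "'a \<Rightarrow> real \<times> real"
  assumes "f \<in> borel_measurable M"
  shows "(\<lambda>x. fst (f x)) \<in> borel_measurable M" "(\<lambda>x. snd (f x)) \<in> borel_measurable M"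
  by (rule measurable_compose[OF assms], rule borel_measurable_continuous_onI, intro continuous_intros)+

lemma gauss_measurable [measurable]: "gauss \<in> borel_measurable borel"
  unfolding gauss_def by measurable

lemma norm_gauss: "cmod (gauss t) = exp (- pi * t\<^sup>2)"
  by (simp add: gauss_def)

lemma cnj_gauss [simp]: "cnj (gauss t) = gauss t"
  by (simp add: gauss_def)

lemma shifted_gaussian_integrable:
  fixes a :: real
  assumes "a > 0"
  shows "integrable lborel (\<lambda>t. exp (- pi * (a * (t - x))\<^sup>2))"
  using lborel_integrable_real_affine[OF gaussian_integrable[OF assms], of 1 "- x"] by simp

lemma shifted_gaussian_integral:
  fixes a :: real
  assumes "a > 0"
  shows "(LINT t|lborel. exp (- pi * (a * (t - x))\<^sup>2)) = 1 / a"
  using lborel_integral_real_affine[of 1 "\<lambda>t. exp (- pi * (a * t)\<^sup>2)" "- x"] gaussian_integral[OF assms]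
  by simp

lemma cis_measurable [measurable (raw)]:
  "f \<in> borel_measurable M \<Longrightarrow> (\<lambda>x. cis (f x)) \<in> borel_measurable M"
  unfolding cis_conv_exp by measurable

lemma cnj_measurable [measurable (raw)]:
  assumes "f \<in> borel_measurable M"
  shows "(\<lambda>x. cnj (f x)) \<in> borel_measurable M"
  by (rule measurable_compose[OF assms], rule borel_measurable_continuous_onI, intro continuous_intros)

lemma tf_shift_gauss: "tf_shift x \<xi> gauss t = cis (2 * pi * \<xi> * t) * gauss (t - x)"
  by (simp add: tf_shift_def modulation_def translation_def)

lemma stft_gauss: "stft gauss f x \<xi> = (LINT t|lborel. f t * gauss (t - x) * cis (- 2 * pi * \<xi> * t))"
  by (simp add: stft_def L2_inner_def tf_shift_gauss cis_cnj mult.assoc mult.commute[of "cis _"])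

lemma L2_mult_gauss_integrable:
  assumes "f \<in> L2"
  shows "integrable lborel (\<lambda>t. f t * gauss (t - x))"
proof (rule Bochner_Integration.integrable_bound)
  have [measurable]: "f \<in> borel_measurable borel" using assms by (simp add: L2_def)
  show "integrable lborel (\<lambda>t. (cmod (f t))\<^sup>2 + exp (- pi * (sqrt 2 * (t - x))\<^sup>2))"
    using assms shifted_gaussian_integrable[of "sqrt 2" x] by (simp add: L2_def)
  show "(\<lambda>t. f t * gauss (t - x)) \<in> borel_measurable lborel" by measurable
  show "AE t in lborel. norm (f t * gauss (t - x)) \<le> norm ((cmod (f t))\<^sup>2 + exp (- pi * (sqrt 2 * (t - x))\<^sup>2))"
  proof (rule AE_I2)
    fix t
    have "exp (- pi * (sqrt 2 * (t - x))\<^sup>2) = (cmod (gauss (t - x)))\<^sup>2"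
      by (simp add: norm_gauss power_mult_distrib flip: exp_double)
    moreover have "2 * (cmod (f t) * cmod (gauss (t - x))) \<le> (cmod (f t))\<^sup>2 + (cmod (gauss (t - x)))\<^sup>2"
      using sum_squares_bound[of "cmod (f t)" "cmod (gauss (t - x))"] by simp
    moreover have "0 \<le> cmod (f t) * cmod (gauss (t - x))" by simp
    ultimately show "norm (f t * gauss (t - x)) \<le> norm ((cmod (f t))\<^sup>2 + exp (- pi * (sqrt 2 * (t - x))\<^sup>2))"
      unfolding norm_mult real_norm_def by linarith
  qed
qed

lemma S0D:
  assumes "f \<in> S0"
  shows "f \<in> L2" "continuous_on UNIV f" "f \<in> borel_measurable borel"
    "integrable lborel (\<lambda>(x, \<xi>). stft gauss f x \<xi>)"
    "(\<lambda>(x, \<xi>). stft gauss f x \<xi>) \<in> borel_measurable borel"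
  using assms by (auto simp: S0_def L2_def dest: borel_measurable_integrable)

lemma stft_gauss_measurable:
  assumes "f \<in> S0" "g \<in> borel_measurable M" "h \<in> borel_measurable M"
  shows "(\<lambda>p. stft gauss f (g p) (h p)) \<in> borel_measurable M"
proof -
  have "(\<lambda>p. (case (g p, h p) of (x, \<xi>) \<Rightarrow> stft gauss f x \<xi>)) \<in> borel_measurable M"
    by (rule measurable_compose[OF _ S0D(5)[OF assms(1)]]) (use assms in measurable)
  then show ?thesis by simp
qed

lemma tf_shift_gauss_measurable [measurable (raw)]:
  assumes "a \<in> borel_measurable M" "b \<in> borel_measurable M" "c \<in> borel_measurable M"
  shows "(\<lambda>p. tf_shift (a p) (b p) gauss (c p)) \<in> borel_measurable M"
  unfolding tf_shift_gauss using assms by measurable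

lemma norm_tf_shift_gauss: "cmod (tf_shift x \<xi> gauss t) = exp (- pi * (t - x)\<^sup>2)"
  by (simp add: tf_shift_gauss norm_mult norm_gauss)

lemma S0_synthesis_integrable:
  assumes f: "f \<in> S0"
  shows "integrable lborel (\<lambda>(x, \<xi>). stft gauss f x \<xi> * tf_shift x \<xi> gauss t)"
proof (rule Bochner_Integration.integrable_bound[OF S0D(4)[OF f]])
  show "(\<lambda>(x, \<xi>). stft gauss f x \<xi> * tf_shift x \<xi> gauss t) \<in> borel_measurable lborel"
    unfolding case_prod_beta
    by (intro borel_measurable_times stft_gauss_measurable[OF f]) measurable
qed (auto simp: case_prod_beta norm_mult norm_tf_shift_gauss intro!: mult_left_le AE_I2)

text \<open>
  For fixed \<open>x\<close>, the function \<open>\<xi> \<mapsto> stft gauss f x \<xi>\<close> is the Fourier transform of the continuous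
  integrable function \<open>t \<mapsto> f t * gauss (t - x)\<close>. By Fubini it is integrable for almost every \<open>x\<close>, and
  then Fourier inversion recovers \<open>f t * gauss (t - x)\<close> for every \<open>t\<close>. Multiplying by \<open>gauss (t - x)\<close>
  and integrating over \<open>x\<close> leaves \<open>f t\<close> times the squared norm \<open>1 / sqrt 2\<close> of the Gaussian.
\<close>

lemma S0_reconstruction:
  assumes f: "f \<in> S0"
  shows "f t = sqrt 2 * (LINT (x, \<xi>)|lborel. stft gauss f x \<xi> * tf_shift x \<xi> gauss t)"
proof -
  let ?H = "\<lambda>(x, \<xi>). stft gauss f x \<xi> * tf_shift x \<xi> gauss t"
  have inner: "AE x in lborel. (LINT \<xi>|lborel. ?H (x, \<xi>)) = f t * of_real (exp (- pi * (sqrt 2 * (x - t))\<^sup>2))"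
    using lborel_pair.AE_integrable_fst'[OF S0D(4)[OF f, folded lborel_prod]]
  proof eventually_elim
    case (elim x)
    have "(LINT \<xi>|lborel. stft gauss f x \<xi> * cis (2 * pi * \<xi> * t)) = f t * gauss (t - x)"
      unfolding stft_gauss
    proof (rule fourier_inversion)
      show "continuous_on UNIV (\<lambda>t. f t * gauss (t - x))"
        using S0D(2)[OF f] by (auto simp: gauss_def intro!: continuous_intros)
      show "integrable lborel (\<lambda>t. f t * gauss (t - x))"
        by (rule L2_mult_gauss_integrable[OF S0D(1)[OF f]])
    qed (use elim in \<open>simp add: stft_gauss\<close>)
    moreover have "(LINT \<xi>|lborel. ?H (x, \<xi>)) = (LINT \<xi>|lborel. stft gauss f x \<xi> * cis (2 * pi * \<xi> * t)) * gauss (t - x)"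
      by (simp add: tf_shift_gauss flip: mult.assoc)
    moreover have "gauss (t - x) * gauss (t - x) = of_real (exp (- pi * (sqrt 2 * (x - t))\<^sup>2))"
      by (simp add: gauss_def power_mult_distrib power2_commute[of t x] flip: exp_double of_real_mult exp_add)
    ultimately show ?case by (simp add: mult.assoc)
  qed
  have int: "integrable (lborel \<Otimes>\<^sub>M lborel) ?H"
    unfolding lborel_prod by (rule S0_synthesis_integrable[OF f])
  have "(LINT p|lborel. ?H p) = (LINT x|lborel. LINT \<xi>|lborel. ?H (x, \<xi>))"
    using lborel_pair.integral_fst'[OF int] by (simp add: lborel_prod)
  also have "\<dots> = (LINT x|lborel. f t * of_real (exp (- pi * (sqrt 2 * (x - t))\<^sup>2)))"
    by (rule integral_cong_AE) (use inner lborel_pair.integrable_fst'[OF int] in auto)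
  also have "\<dots> = f t * of_real (1 / sqrt 2)"
    using shifted_gaussian_integral[of "sqrt 2" t] by (simp del: of_real_exp)
  finally show ?thesis by simp
qed

lemma S0_pointwise_bound:
  assumes f: "f \<in> S0"
  shows "cmod (f t) \<le> (LINT p|lborel. cmod (case p of (x, \<xi>) \<Rightarrow> stft gauss f x \<xi>) * (sqrt 2 * exp (- pi * (t - fst p)\<^sup>2)))"
proof -
  have "cmod (f t) \<le> sqrt 2 * (LINT p|lborel. cmod (case p of (x, \<xi>) \<Rightarrow> stft gauss f x \<xi> * tf_shift x \<xi> gauss t))"
    by (subst S0_reconstruction[OF f]) (simp add: norm_mult integral_norm_bound)
  also have "\<dots> = (LINT p|lborel. cmod (case p of (x, \<xi>) \<Rightarrow> stft gauss f x \<xi>) * (sqrt 2 * exp (- pi * (t - fst p)\<^sup>2)))"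
    by (subst integral_mult_right_zero[symmetric], rule Bochner_Integration.integral_cong)
       (auto simp: norm_mult norm_tf_shift_gauss)
  finally show ?thesis .
qed

section \<open>Absolute convergence of lattice sums\<close>

text \<open>
  The summability statements about \<open>S0\<close> rest on this: \<open>V\<close> is the short-time Fourier transform
  and \<open>b k\<close> the effect of the \<open>k\<close>-th lattice point on a single Gaussian atom.
\<close>

lemma sum_integral_kernel_bound:
  fixes V :: "'a \<Rightarrow> complex" and b :: "'i \<Rightarrow> 'a \<Rightarrow> real" and a :: "'i \<Rightarrow> real"
  assumes F: "finite F" and V: "integrable M V"
    and b_meas: "\<And>k. k \<in> F \<Longrightarrow> b k \<in> borel_measurable M" and b_nonneg: "\<And>k p. k \<in> F \<Longrightarrow> b k p \<ge> 0"
    and b_sum: "\<And>p. (\<Sum>k\<in>F. b k p) \<le> C"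
    and a: "\<And>k. k \<in> F \<Longrightarrow> a k \<le> (LINT p|M. cmod (V p) * b k p)"
  shows "(\<Sum>k\<in>F. a k) \<le> C * (LINT p|M. cmod (V p))"
proof -
  have b_le: "b k p \<le> C" if "k \<in> F" for k p
    using member_le_sum[of k F "\<lambda>k. b k p"] b_nonneg that F b_sum[of p] by fastforce
  have int: "integrable M (\<lambda>p. cmod (V p) * b k p)" if k: "k \<in> F" for k
  proof (rule Bochner_Integration.integrable_bound)
    show "integrable M (\<lambda>p. cmod (V p) * C)" using V by simp
    show "(\<lambda>p. cmod (V p) * b k p) \<in> borel_measurable M" using V b_meas[OF k] by measurable
    show "AE p in M. norm (cmod (V p) * b k p) \<le> norm (cmod (V p) * C)"
      using b_le[OF k] b_nonneg[OF k]
      by (intro AE_I2) (auto simp: abs_mult intro!: mult_left_mono intro: order_trans[OF _ abs_ge_self])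
  qed
  have "(\<Sum>k\<in>F. a k) \<le> (\<Sum>k\<in>F. (LINT p|M. cmod (V p) * b k p))"
    by (rule sum_mono) (rule a)
  also have "\<dots> = (LINT p|M. (\<Sum>k\<in>F. cmod (V p) * b k p))"
    by (rule Bochner_Integration.integral_sum[symmetric]) (rule int)
  also have "\<dots> \<le> (LINT p|M. C * cmod (V p))"
  proof (rule integral_mono)
    show "integrable M (\<lambda>p. \<Sum>k\<in>F. cmod (V p) * b k p)"
      by (rule Bochner_Integration.integrable_sum) (rule int)
    show "(\<Sum>k\<in>F. cmod (V p) * b k p) \<le> C * cmod (V p)" for p
      using mult_left_mono[OF b_sum[of p], of "cmod (V p)"] by (simp add: sum_distrib_left mult.commute)
  qed (use V in simp)
  finally show ?thesis by simp
qed

lemma abs_le_abs_square_int: "\<bar>d\<bar> \<le> \<bar>d\<bar>\<^sup>2" for d :: int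
proof (cases "d = 0")
  case False
  then have "\<bar>d\<bar> * 1 \<le> \<bar>d\<bar> * \<bar>d\<bar>" by (intro mult_left_mono) auto
  then show ?thesis by (simp add: power2_eq_square)
qed simp

text \<open>
  Uniformity in the shift \<open>x\<close> is the point. Up to the constant \<open>exp (c * a\<^sup>2)\<close>, a shift can be
  rounded to a lattice point, which only reindexes a geometric series over the integers.
\<close>

lemma gaussian_lattice_sum_bounded:
  fixes a c :: real
  assumes a: "a > 0" and c: "c > 0"
  shows "\<exists>C. \<forall>x F. finite F \<longrightarrow> (\<Sum>n\<in>F. exp (- c * (a * of_int n - x)\<^sup>2)) \<le> C"
proof -
  define b where "b = c * a\<^sup>2 / 2"
  define q where "q = exp (- b)"
  have b: "b > 0" using a c by (simp add: b_def)
  have q: "0 < q" "q < 1" using b by (auto simp: q_def)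
  define Q where "Q = (\<Sum>n. q ^ n)"
  have sumQ: "(\<Sum>n\<in>F. q ^ n) \<le> Q" if "finite F" for F
    unfolding Q_def using q that by (intro sum_le_suminf summable_geometric) auto
  have two_sided: "(\<Sum>d\<in>F. q ^ nat \<bar>d\<bar>) \<le> Q + Q" if F: "finite F" for F :: "int set"
  proof -
    have "(\<Sum>d\<in>F. q ^ nat \<bar>d\<bar>) = (\<Sum>d\<in>F \<inter> {d. d \<ge> 0}. q ^ nat \<bar>d\<bar>) + (\<Sum>d\<in>F \<inter> - {d. d \<ge> 0}. q ^ nat \<bar>d\<bar>)"
      using F by (rule sum.Int_Diff[of F _ "{d. d \<ge> 0}", unfolded Diff_eq])
    also have "(\<Sum>d\<in>F \<inter> {d. d \<ge> 0}. q ^ nat \<bar>d\<bar>) = (\<Sum>n\<in>(\<lambda>d. nat \<bar>d\<bar>) ` (F \<inter> {d. d \<ge> 0}). q ^ n)"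
      by (subst sum.reindex) (auto simp: inj_on_def)
    also have "\<dots> \<le> Q" using F by (intro sumQ) auto
    also have "(\<Sum>d\<in>F \<inter> - {d. d \<ge> 0}. q ^ nat \<bar>d\<bar>) = (\<Sum>n\<in>(\<lambda>d. nat \<bar>d\<bar>) ` (F \<inter> - {d. d \<ge> 0}). q ^ n)"
      by (subst sum.reindex) (auto simp: inj_on_def)
    also have "\<dots> \<le> Q" using F by (intro sumQ) auto
    finally show ?thesis by simp
  qed
  have "(\<Sum>n\<in>F. exp (- c * (a * of_int n - x)\<^sup>2)) \<le> exp (c * a\<^sup>2) * (Q + Q)" if F: "finite F" for x F
  proof -
    \<comment> \<open>The lattice point below x, and the remaining fraction of a cell.\<close>
    define m where "m = \<lfloor>x / a\<rfloor>"
    define s where "s = x / a - of_int m"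
    have s: "0 \<le> s" "s \<le> 1" unfolding s_def m_def by linarith+
    have x: "x = a * (of_int m + s)" using a by (simp add: s_def)
    have bound: "exp (- c * (a * of_int n - x)\<^sup>2) \<le> exp (c * a\<^sup>2) * q ^ nat \<bar>n - m\<bar>" for n
    proof -
      define d where "d = n - m"
      have "(real_of_int d - s)\<^sup>2 = (of_int d)\<^sup>2 / 2 - s\<^sup>2 + (of_int d - 2 * s)\<^sup>2 / 2"
        by (simp add: power2_diff power_mult_distrib) (simp add: field_simps)
      moreover have "s\<^sup>2 \<le> 1" using s by (simp add: power_le_one)
      moreover have "\<bar>d\<bar> \<le> \<bar>d\<bar>\<^sup>2"
        by (rule abs_le_abs_square_int)
      then have "real_of_int \<bar>d\<bar> \<le> real_of_int (\<bar>d\<bar>\<^sup>2)" by (simp only: of_int_le_iff)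
      then have "real_of_int \<bar>d\<bar> \<le> (of_int d)\<^sup>2" by simp
      ultimately have ge: "real_of_int \<bar>d\<bar> / 2 - 1 \<le> (of_int d - s)\<^sup>2"
        using zero_le_power2[of "of_int d - 2 * s"] by linarith
      have "c * a\<^sup>2 * (real_of_int \<bar>d\<bar> / 2 - 1) \<le> c * a\<^sup>2 * (of_int d - s)\<^sup>2"
        using a c by (intro mult_left_mono ge) auto
      moreover have "c * (a * of_int n - x)\<^sup>2 = c * a\<^sup>2 * (of_int d - s)\<^sup>2"
        by (simp add: x d_def power2_eq_square algebra_simps)
      moreover have "c * a\<^sup>2 * (real_of_int \<bar>d\<bar> / 2 - 1) = real (nat \<bar>d\<bar>) * b - c * a\<^sup>2"
        by (simp add: b_def algebra_simps)
      ultimately have "real (nat \<bar>d\<bar>) * b - c * a\<^sup>2 \<le> c * (a * of_int n - x)\<^sup>2"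
        by (simp only:)
      then have "- c * (a * of_int n - x)\<^sup>2 \<le> c * a\<^sup>2 + real (nat \<bar>d\<bar>) * (- b)"
        by simp
      then have "exp (- c * (a * of_int n - x)\<^sup>2) \<le> exp (c * a\<^sup>2 + real (nat \<bar>d\<bar>) * (- b))"
        by simp
      also have "\<dots> = exp (c * a\<^sup>2) * q ^ nat \<bar>n - m\<bar>"
        unfolding q_def d_def exp_add exp_of_nat_mult by simp
      finally show ?thesis .
    qed
    have "(\<Sum>n\<in>F. exp (- c * (a * of_int n - x)\<^sup>2)) \<le> (\<Sum>n\<in>F. exp (c * a\<^sup>2) * q ^ nat \<bar>n - m\<bar>)"
      by (rule sum_mono) (rule bound)
    also have "\<dots> = exp (c * a\<^sup>2) * (\<Sum>d\<in>(\<lambda>n. n - m) ` F. q ^ nat \<bar>d\<bar>)"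
      by (subst sum.reindex) (auto simp: inj_on_def sum_distrib_left)
    also have "\<dots> \<le> exp (c * a\<^sup>2) * (Q + Q)"
      using F by (intro mult_left_mono two_sided) auto
    finally show ?thesis .
  qed
  then show ?thesis by blast
qed

lemma S0_norm_altdef: "S0_norm f = (LINT p|lborel. cmod (case p of (x, \<xi>) \<Rightarrow> stft gauss f x \<xi>))"
  unfolding S0_norm_def by (rule Bochner_Integration.integral_cong) auto

text \<open>
  The periodization series converges absolutely, with a bound independent of \<open>t\<close>.
\<close>

lemma S0_translates_bounded:
  assumes f: "f \<in> S0"
  shows "\<exists>C. \<forall>t F. finite F \<longrightarrow> (\<Sum>k\<in>F. cmod (f (t - of_int k))) \<le> C"
proof -
  obtain C where C: "\<And>x F. finite F \<Longrightarrow> (\<Sum>n\<in>F. exp (- pi * (1 * of_int n - x)\<^sup>2)) \<le> C"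
    using gaussian_lattice_sum_bounded[of 1 pi] by auto
  have "(\<Sum>k\<in>F. cmod (f (t - of_int k))) \<le> sqrt 2 * C * S0_norm f" if F: "finite F" for t F
    unfolding S0_norm_altdef
  proof (rule sum_integral_kernel_bound[OF F S0D(4)[OF f]])
    fix k and p :: "real \<times> real"
    show "(\<lambda>p :: real \<times> real. sqrt 2 * exp (- pi * (t - of_int k - fst p)\<^sup>2)) \<in> borel_measurable lborel" by measurable
    show "(\<Sum>k\<in>F. sqrt 2 * exp (- pi * (t - of_int k - fst p)\<^sup>2)) \<le> sqrt 2 * C"
    proof -
      have "(t - of_int k - fst p)\<^sup>2 = (1 * of_int k - (t - fst p))\<^sup>2" for k
        by (subst power2_commute) (simp add: algebra_simps)
      then show ?thesis using C[OF F, of "t - fst p"] by (simp add: sum_distrib_left[symmetric])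
    qed
    show "cmod (f (t - of_int k)) \<le> (LINT p|lborel. cmod (case p of (x, \<xi>) \<Rightarrow> stft gauss f x \<xi>) * (sqrt 2 * exp (- pi * (t - of_int k - fst p)\<^sup>2)))"
      by (rule S0_pointwise_bound[OF f])
  qed auto
  then show ?thesis by blast
qed

lemma S0_bounded:
  assumes f: "f \<in> S0"
  shows "\<exists>C. \<forall>t. cmod (f t) \<le> C"
proof -
  obtain C where "\<And>t F. finite F \<Longrightarrow> (\<Sum>k\<in>F. cmod (f (t - of_int k))) \<le> C"
    using S0_translates_bounded[OF f] by blast
  from this[of "{0}"] show ?thesis by auto
qed

text \<open>
  Suprema over the cells of a lattice are summable. This is the majorant that Poisson summation
  asks for. The Gaussian centred at \<open>x\<close> varies within a cell by at most a factor, at the price of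
  halving its exponent: \<open>(d + e)\<^sup>2 \<ge> d\<^sup>2 / 2 - e\<^sup>2\<close>.
\<close>

lemma S0_wiener_amalgam:
  assumes f: "f \<in> S0" and a: "a > 0"
  obtains M :: "int \<Rightarrow> real" where "M summable_on UNIV"
    "\<And>n t. \<bar>t\<bar> \<le> 1/2 \<Longrightarrow> cmod (f (a * (of_int n + t))) \<le> M n"
proof
  let ?K = "\<lambda>n x. sqrt 2 * exp (pi * a\<^sup>2) * exp (- (pi / 2) * (a * of_int n - x)\<^sup>2)"
  let ?V = "\<lambda>(x, \<xi>). stft gauss f x \<xi>"
  define M where "M n = (LINT p|lborel. cmod (?V p) * ?K n (fst p))" for n
  obtain C where C: "\<And>x F. finite F \<Longrightarrow> (\<Sum>n\<in>F. exp (- (pi / 2) * (a * of_int n - x)\<^sup>2)) \<le> C"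
    using gaussian_lattice_sum_bounded[OF a, of "pi / 2"] by auto
  have K_int: "integrable lborel (\<lambda>p. cmod (?V p) * ?K n (fst p))" for n
  proof (rule Bochner_Integration.integrable_bound)
    show "integrable lborel (\<lambda>p. ?V p * (sqrt 2 * exp (pi * a\<^sup>2)))"
      using S0D(4)[OF f] by (rule integrable_mult_left)
    show "(\<lambda>p. cmod (?V p) * ?K n (fst p)) \<in> borel_measurable lborel"
      using S0D(5)[OF f] by measurable
  qed (auto simp: norm_mult intro!: mult_left_mono)
  have "(\<Sum>n\<in>F. M n) \<le> sqrt 2 * exp (pi * a\<^sup>2) * C * (LINT p|lborel. cmod (?V p))" if F: "finite F" for F
    unfolding M_def
  proof (rule sum_integral_kernel_bound[OF F S0D(4)[OF f]])
    show "(\<lambda>p :: real \<times> real. ?K n (fst p)) \<in> borel_measurable lborel" for n by measurable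
    show "(\<Sum>n\<in>F. ?K n (fst p)) \<le> sqrt 2 * exp (pi * a\<^sup>2) * C" for p :: "real \<times> real"
      using C[OF F, of "fst p"] by (simp add: sum_distrib_left[symmetric])
  qed auto
  moreover have "M n \<ge> 0" for n
    unfolding M_def by (intro Bochner_Integration.integral_nonneg) auto
  ultimately show "M summable_on UNIV"
    by (intro nonneg_bdd_above_summable_on) (auto simp: bdd_above_def)
  fix n :: int and t :: real assume t: "\<bar>t\<bar> \<le> 1/2"
  have "cmod (f (a * (of_int n + t))) \<le>
      (LINT p|lborel. cmod (?V p) * (sqrt 2 * exp (- pi * (a * (of_int n + t) - fst p)\<^sup>2)))"
    by (rule S0_pointwise_bound[OF f])
  also have "\<dots> \<le> M n"
    unfolding M_def
  proof (rule integral_mono[OF _ K_int])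
    show "integrable lborel (\<lambda>p. cmod (?V p) * (sqrt 2 * exp (- pi * (a * (of_int n + t) - fst p)\<^sup>2)))"
    proof (rule Bochner_Integration.integrable_bound)
      show "integrable lborel (\<lambda>p. ?V p * sqrt 2)"
        using S0D(4)[OF f] by (rule integrable_mult_left)
      show "(\<lambda>p. cmod (?V p) * (sqrt 2 * exp (- pi * (a * (of_int n + t) - fst p)\<^sup>2))) \<in> borel_measurable lborel"
        using S0D(5)[OF f] by measurable
    qed (auto simp: norm_mult intro!: mult_left_mono)
    fix p :: "real \<times> real"
    define d where "d = a * of_int n - fst p"
    have "t\<^sup>2 \<le> 1" using t by (simp add: abs_square_le_1)
    then have "(a * t)\<^sup>2 \<le> a\<^sup>2" by (simp add: power_mult_distrib mult_left_le)
    moreover have "(d + a * t)\<^sup>2 = d\<^sup>2 / 2 - (a * t)\<^sup>2 + (d + 2 * (a * t))\<^sup>2 / 2"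
      by (simp add: power2_sum power_mult_distrib) (simp add: field_simps)
    ultimately have "d\<^sup>2 / 2 - a\<^sup>2 \<le> (d + a * t)\<^sup>2"
      using zero_le_power2[of "d + 2 * (a * t)"] by linarith
    from mult_left_mono[OF this pi_ge_zero]
    have "exp (- pi * (d + a * t)\<^sup>2) \<le> exp (pi * a\<^sup>2 + - (pi / 2) * d\<^sup>2)"
      by (simp add: algebra_simps)
    then show "cmod (?V p) * (sqrt 2 * exp (- pi * (a * (of_int n + t) - fst p)\<^sup>2)) \<le> cmod (?V p) * ?K n (fst p)"
      unfolding exp_add by (intro mult_left_mono) (auto simp: d_def algebra_simps)
  qed
  finally show "cmod (f (a * (of_int n + t))) \<le> M n" .
qed

text \<open>
  The integrand is dominated by \<open>B * cmod (stft gauss f x \<xi>) * exp (- pi * (t - x)\<^sup>2)\<close>, whose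
  integral over \<open>t\<close> is \<open>B * cmod (stft gauss f x \<xi>)\<close>.
\<close>

lemma S0_expansion_integrable:
  assumes f: "f \<in> S0" and u: "u \<in> borel_measurable borel" and B: "\<And>t. cmod (u t) \<le> B"
  shows "integrable (lborel \<Otimes>\<^sub>M lborel)
    (\<lambda>(p, t). (case p of (x, \<xi>) \<Rightarrow> stft gauss f x \<xi> * tf_shift x \<xi> gauss t) * u t)"
proof -
  let ?V = "\<lambda>p. case p of (x, \<xi>) \<Rightarrow> stft gauss f x \<xi>"
  have [measurable]: "u \<in> borel_measurable borel" by (rule u)
  have x_meas [measurable]: "(\<lambda>q :: (real \<times> real) \<times> real. fst (fst q)) \<in> borel_measurable (lborel \<Otimes>\<^sub>M lborel)"
    and \<xi>_meas [measurable]: "(\<lambda>q :: (real \<times> real) \<times> real. snd (fst q)) \<in> borel_measurable (lborel \<Otimes>\<^sub>M lborel)"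
    unfolding lborel_prod measurable_lborel2
    by (intro borel_measurable_continuous_onI continuous_intros)+
  note V_meas [measurable] = stft_gauss_measurable[OF f x_meas \<xi>_meas]
  have B0: "B \<ge> 0" using order_trans[OF norm_ge_zero B] .
  have bound: "integrable (lborel \<Otimes>\<^sub>M lborel)
      (\<lambda>(p, t). ?V p * of_real (B * exp (- pi * (1 * (t - fst p))\<^sup>2)))"
  proof (rule lborel_pair.Fubini_integrable)
    show "(\<lambda>(p, t). ?V p * of_real (B * exp (- pi * (1 * (t - fst p))\<^sup>2))) \<in> borel_measurable (lborel \<Otimes>\<^sub>M lborel)"
      unfolding case_prod_beta' by measurable
    have "(LINT t|lborel. norm (?V p * of_real (B * exp (- pi * (1 * (t - fst p))\<^sup>2)))) = cmod (?V p) * B" for p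
    proof -
      have "(LINT t|lborel. norm (?V p * of_real (B * exp (- pi * (1 * (t - fst p))\<^sup>2))))
          = (LINT t|lborel. (cmod (?V p) * B) * exp (- pi * (1 * (t - fst p))\<^sup>2))"
        using B0 by (intro Bochner_Integration.integral_cong refl) (simp add: norm_mult abs_mult mult.assoc)
      also have "\<dots> = cmod (?V p) * B"
        by (subst integral_mult_right_zero, subst shifted_gaussian_integral) auto
      finally show ?thesis .
    qed
    moreover have "integrable lborel (\<lambda>p. cmod (?V p) * B)"
      using S0D(4)[OF f] by simp
    ultimately show "integrable lborel (\<lambda>p. LINT t|lborel.
        norm (case (p, t) of (p, t) \<Rightarrow> ?V p * of_real (B * exp (- pi * (1 * (t - fst p))\<^sup>2))))"
      by simp
    have "integrable lborel (\<lambda>t. ?V p * of_real (B * exp (- pi * (1 * (t - fst p))\<^sup>2)))" for p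
      using shifted_gaussian_integrable[of 1 "fst p"]
      by (intro integrable_mult_right integrable_of_real) simp
    then show "AE p in lborel. integrable lborel
        (\<lambda>t. case (p, t) of (p, t) \<Rightarrow> ?V p * of_real (B * exp (- pi * (1 * (t - fst p))\<^sup>2)))"
      by simp
  qed
  show ?thesis
  proof (rule Bochner_Integration.integrable_bound[OF bound])
    have "(\<lambda>q. stft gauss f (fst (fst q)) (snd (fst q)) * tf_shift (fst (fst q)) (snd (fst q)) gauss (snd q) * u (snd q))
        \<in> borel_measurable (lborel \<Otimes>\<^sub>M lborel)"
      unfolding tf_shift_gauss by measurable
    then show "(\<lambda>(p, t). (case p of (x, \<xi>) \<Rightarrow> stft gauss f x \<xi> * tf_shift x \<xi> gauss t) * u t)
        \<in> borel_measurable (lborel \<Otimes>\<^sub>M lborel)"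
      by (simp add: case_prod_beta')
    show "AE q in lborel \<Otimes>\<^sub>M lborel.
        norm (case q of (p, t) \<Rightarrow> (case p of (x, \<xi>) \<Rightarrow> stft gauss f x \<xi> * tf_shift x \<xi> gauss t) * u t)
        \<le> norm (case q of (p, t) \<Rightarrow> ?V p * of_real (B * exp (- pi * (1 * (t - fst p))\<^sup>2)))"
    proof (rule AE_I2)
      fix q :: "(real \<times> real) \<times> real"
      obtain x \<xi> t where q: "q = ((x, \<xi>), t)" by (metis surj_pair)
      have "exp (- pi * (t - x)\<^sup>2) * cmod (u t) \<le> B * exp (- pi * (t - x)\<^sup>2)"
        using B[of t] by (simp add: mult.commute mult_left_mono)
      then have "cmod (stft gauss f x \<xi>) * (exp (- pi * (t - x)\<^sup>2) * cmod (u t))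
          \<le> cmod (stft gauss f x \<xi>) * (B * exp (- pi * (t - x)\<^sup>2))"
        by (rule mult_left_mono) simp
      then show "norm (case q of (p, t) \<Rightarrow> (case p of (x, \<xi>) \<Rightarrow> stft gauss f x \<xi> * tf_shift x \<xi> gauss t) * u t)
        \<le> norm (case q of (p, t) \<Rightarrow> ?V p * of_real (B * exp (- pi * (1 * (t - fst p))\<^sup>2)))"
        using B0 by (simp add: q norm_mult norm_tf_shift_gauss mult.assoc)
    qed
  qed
qed

text \<open>
  The reconstruction formula integrated against \<open>u\<close>: a pairing with \<open>f\<close> is an absolutely convergent
  superposition of the pairings with Gaussian atoms.
\<close>

lemma
  assumes f: "f \<in> S0" and u: "u \<in> borel_measurable borel" and B: "\<And>t. cmod (u t) \<le> B"
  shows S0_mult_bounded_integrable: "integrable lborel (\<lambda>t. f t * u t)"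
    and S0_weak_expansion: "(LINT t|lborel. f t * u t)
      = (LINT p|lborel. (case p of (x, \<xi>) \<Rightarrow> stft gauss f x \<xi>) *
           (sqrt 2 * (LINT t|lborel. tf_shift (fst p) (snd p) gauss t * u t)))"
proof -
  let ?J = "\<lambda>p t. (case p of (x, \<xi>) \<Rightarrow> stft gauss f x \<xi> * tf_shift x \<xi> gauss t) * u t"
  have int: "integrable (lborel \<Otimes>\<^sub>M lborel) (\<lambda>(p, t). ?J p t)"
    by (rule S0_expansion_integrable[OF f u B])
  have inner: "(LINT p|lborel. ?J p t) = f t * u t / sqrt 2" for t
    unfolding integral_mult_left_zero using S0_reconstruction[OF f, of t] by simp
  show "integrable lborel (\<lambda>t. f t * u t)"
    using integrable_mult_left[OF lborel_pair.integrable_snd[OF int], of "sqrt 2"] unfolding inner by simp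
  have "(LINT t|lborel. f t * u t) = sqrt 2 * (LINT t|lborel. LINT p|lborel. ?J p t)"
    unfolding inner by simp
  also have "\<dots> = sqrt 2 * (LINT p|lborel. LINT t|lborel. ?J p t)"
    using lborel_pair.Fubini_integral[OF int] by simp
  also have "\<dots> = (LINT p|lborel. sqrt 2 * (LINT t|lborel. ?J p t))"
    by simp
  also have "\<dots> = (LINT p|lborel. (case p of (x, \<xi>) \<Rightarrow> stft gauss f x \<xi>) *
           (sqrt 2 * (LINT t|lborel. tf_shift (fst p) (snd p) gauss t * u t)))"
    by (intro Bochner_Integration.integral_cong refl) (auto simp: mult.assoc)
  finally show "(LINT t|lborel. f t * u t)
      = (LINT p|lborel. (case p of (x, \<xi>) \<Rightarrow> stft gauss f x \<xi>) *
           (sqrt 2 * (LINT t|lborel. tf_shift (fst p) (snd p) gauss t * u t)))" .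
qed

lemma norm_S0_pairing_le:
  assumes f: "f \<in> S0" and u: "u \<in> borel_measurable borel" and B: "\<And>t. cmod (u t) \<le> B"
  shows "cmod (LINT t|lborel. f t * u t)
      \<le> (LINT p|lborel. cmod (case p of (x, \<xi>) \<Rightarrow> stft gauss f x \<xi>) *
           (sqrt 2 * cmod (LINT t|lborel. tf_shift (fst p) (snd p) gauss t * u t)))"
  unfolding S0_weak_expansion[OF assms]
  by (rule order_trans[OF integral_norm_bound]) (simp add: norm_mult)

text \<open>
  The product of two shifted Gaussians is a Gaussian around the midpoint of their centres, so the
  integral is again a Gaussian Fourier transform.
\<close>

lemma norm_gauss_ambiguity:
  "cmod (LINT t|lborel. tf_shift x \<xi> gauss t * cnj (tf_shift y \<eta> gauss t))
    = exp (- (pi / 2) * (x - y)\<^sup>2) * exp (- (pi / 2) * (\<xi> - \<eta>)\<^sup>2) / sqrt 2"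
proof -
  define m where "m = (x + y) / 2"
  have "(LINT t|lborel. tf_shift x \<xi> gauss t * cnj (tf_shift y \<eta> gauss t))
      = (LINT s|lborel. tf_shift x \<xi> gauss (m + s) * cnj (tf_shift y \<eta> gauss (m + s)))"
    using lborel_integral_real_affine[of 1 _ m] by simp
  also have "\<dots> = (LINT s|lborel. (cis (2 * pi * (\<xi> - \<eta>) * m) * of_real (exp (- (pi / 2) * (x - y)\<^sup>2))) *
      (cis (2 * pi * (\<xi> - \<eta>) * s) * of_real (exp (- pi * (sqrt 2 * s)\<^sup>2))))"
  proof (intro Bochner_Integration.integral_cong refl)
    fix s :: real
    have "- pi * (m + s - x)\<^sup>2 + - pi * (m + s - y)\<^sup>2 = - (pi / 2) * (x - y)\<^sup>2 + - pi * (sqrt 2 * s)\<^sup>2"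
      by (simp add: m_def power_mult_distrib) (simp add: power2_eq_square field_simps)
    then have window: "gauss (m + s - x) * gauss (m + s - y)
        = of_real (exp (- (pi / 2) * (x - y)\<^sup>2)) * of_real (exp (- pi * (sqrt 2 * s)\<^sup>2))"
      unfolding gauss_def of_real_mult[symmetric] exp_add[symmetric] by simp
    have phase: "cis (2 * pi * \<xi> * (m + s)) * cnj (cis (2 * pi * \<eta> * (m + s)))
        = cis (2 * pi * (\<xi> - \<eta>) * m) * cis (2 * pi * (\<xi> - \<eta>) * s)"
      by (simp add: cis_cnj cis_mult algebra_simps)
    have "tf_shift x \<xi> gauss (m + s) * cnj (tf_shift y \<eta> gauss (m + s)) =
        (cis (2 * pi * \<xi> * (m + s)) * cnj (cis (2 * pi * \<eta> * (m + s)))) *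
        (gauss (m + s - x) * gauss (m + s - y))"
      unfolding tf_shift_gauss complex_cnj_mult cnj_gauss by (simp only: mult_ac)
    then show "tf_shift x \<xi> gauss (m + s) * cnj (tf_shift y \<eta> gauss (m + s)) =
      (cis (2 * pi * (\<xi> - \<eta>) * m) * of_real (exp (- (pi / 2) * (x - y)\<^sup>2))) *
      (cis (2 * pi * (\<xi> - \<eta>) * s) * of_real (exp (- pi * (sqrt 2 * s)\<^sup>2)))"
      unfolding phase window by (simp only: mult_ac)
  qed
  also have "\<dots> = (cis (2 * pi * (\<xi> - \<eta>) * m) * of_real (exp (- (pi / 2) * (x - y)\<^sup>2))) *
      of_real (exp (- pi * ((\<xi> - \<eta>) / sqrt 2)\<^sup>2) / sqrt 2)"
    by (subst integral_mult_right_zero, subst gaussian_fourier_transform) auto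
  finally show ?thesis
    by (simp add: norm_mult norm_divide power_divide)
qed

text \<open>
  Expanding \<open>f\<close> into Gaussian atoms bounds the value at a lattice point by an integral of
  \<open>cmod (stft gauss f x \<xi>)\<close> against the Gaussian of \<open>norm_gauss_ambiguity\<close>, whose lattice
  sums are at most products of two sums over the integers.
\<close>

lemma stft_gauss_lattice_bounded:
  assumes f: "f \<in> S0" and \<beta>: "\<beta> > 0"
  shows "\<exists>C. \<forall>y \<eta> F. finite F \<longrightarrow>
    (\<Sum>(k\<^sub>1 :: int, k\<^sub>2 :: int)\<in>F. cmod (stft gauss f (y - of_int k\<^sub>1) (\<eta> - \<beta> * of_int k\<^sub>2))) \<le> C"
proof -
  obtain C1 where C1: "\<And>x F. finite F \<Longrightarrow> (\<Sum>n\<in>F. exp (- (pi / 2) * (1 * of_int n - x)\<^sup>2)) \<le> C1"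
    using gaussian_lattice_sum_bounded[of 1 "pi / 2"] by auto
  obtain C2 where C2: "\<And>x F. finite F \<Longrightarrow> (\<Sum>n\<in>F. exp (- (pi / 2) * (\<beta> * of_int n - x)\<^sup>2)) \<le> C2"
    using gaussian_lattice_sum_bounded[OF \<beta>, of "pi / 2"] by auto
  have C1_nonneg: "C1 \<ge> 0" using C1[of "{}"] by simp
  define V where "V = (\<lambda>p. case p of (x, \<xi>) \<Rightarrow> stft gauss f x \<xi>)"
  define b where "b y \<eta> k p = exp (- (pi / 2) * (1 * real_of_int (fst k) - (y - fst p))\<^sup>2) *
      exp (- (pi / 2) * (\<beta> * real_of_int (snd k) - (\<eta> - snd p))\<^sup>2)" for y \<eta> :: real and k :: "int \<times> int" and p :: "real \<times> real"
  have "(\<Sum>k\<in>F. cmod (stft gauss f (y - of_int (fst k)) (\<eta> - \<beta> * of_int (snd k))))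
      \<le> C1 * C2 * (LINT p|lborel. cmod (V p))" if F: "finite F" for y \<eta> F
  proof (rule sum_integral_kernel_bound[OF F, where b = "b y \<eta>"])
    show "integrable lborel V" using S0D(4)[OF f] by (simp add: V_def)
    show "b y \<eta> k \<in> borel_measurable lborel" for k
      unfolding b_def by measurable
    show "b y \<eta> k p \<ge> 0" for k p by (simp add: b_def)
    show "(\<Sum>k\<in>F. b y \<eta> k p) \<le> C1 * C2" for p
    proof -
      have "(\<Sum>k\<in>F. b y \<eta> k p) \<le> (\<Sum>k\<in>fst ` F \<times> snd ` F. b y \<eta> k p)"
        using F by (intro sum_mono2) (force simp: b_def)+
      also have "\<dots> = (\<Sum>n\<in>fst ` F. exp (- (pi / 2) * (1 * of_int n - (y - fst p))\<^sup>2)) *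
          (\<Sum>n\<in>snd ` F. exp (- (pi / 2) * (\<beta> * of_int n - (\<eta> - snd p))\<^sup>2))"
        unfolding b_def sum_product sum.cartesian_product by (simp add: case_prod_beta)
      also have "\<dots> \<le> C1 * C2"
        using F C1_nonneg by (intro mult_mono C1 C2 sum_nonneg) auto
      finally show ?thesis .
    qed
    fix k :: "int \<times> int"
    let ?u = "\<lambda>t. cnj (tf_shift (y - of_int (fst k)) (\<eta> - \<beta> * of_int (snd k)) gauss t)"
    have u: "?u \<in> borel_measurable borel" by measurable
    have "cmod (stft gauss f (y - of_int (fst k)) (\<eta> - \<beta> * of_int (snd k))) = cmod (LINT t|lborel. f t * ?u t)"
      by (simp add: stft_def L2_inner_def)
    also have "\<dots> \<le> (LINT p|lborel. cmod (V p) * (sqrt 2 * cmod (LINT t|lborel. tf_shift (fst p) (snd p) gauss t * ?u t)))"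
      unfolding V_def by (rule norm_S0_pairing_le[OF f u, of 1]) (simp add: norm_tf_shift_gauss)
    also have "\<dots> = (LINT p|lborel. cmod (V p) * b y \<eta> k p)"
      unfolding norm_gauss_ambiguity b_def by (simp add: algebra_simps)
    finally show "cmod (stft gauss f (y - of_int (fst k)) (\<eta> - \<beta> * of_int (snd k)))
        \<le> (LINT p|lborel. cmod (V p) * b y \<eta> k p)" .
  qed
  then show ?thesis by (auto simp: case_prod_beta)
qed

definition lattice_pairing :: "nat \<Rightarrow> (real \<Rightarrow> complex) \<Rightarrow> (real \<Rightarrow> complex) \<Rightarrow> int \<Rightarrow> int \<Rightarrow> complex" where
  "lattice_pairing N f h k\<^sub>1 k\<^sub>2 =
     (LINT t|lborel. modulation (of_nat N * of_int k\<^sub>2) (translation (of_int k\<^sub>1) f) t * h t)"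

text \<open>
  Expanding \<open>h\<close> into Gaussian atoms, each atom meets the time-frequency shifts of \<open>f\<close> in
  lattice values of \<open>stft gauss f\<close>, whose sums are uniformly bounded. The bound is linear in
  \<open>S0_norm h\<close>, so it yields both the unconditional convergence of the double periodization and the
  boundedness of its limit.
\<close>

lemma lattice_pairing_bounded:
  assumes f: "f \<in> S0" and N: "N \<ge> 1"
  shows "\<exists>C. \<forall>h\<in>S0. \<forall>F. finite F \<longrightarrow>
    (\<Sum>k\<in>F. cmod (case k of (k\<^sub>1, k\<^sub>2) \<Rightarrow> lattice_pairing N f h k\<^sub>1 k\<^sub>2)) \<le> C * S0_norm h"
proof -
  obtain C where C: "\<And>y \<eta> F. finite F \<Longrightarrow>
    (\<Sum>(k\<^sub>1 :: int, k\<^sub>2 :: int)\<in>F. cmod (stft gauss f (y - of_int k\<^sub>1) (\<eta> - real N * of_int k\<^sub>2))) \<le> C"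
    using stft_gauss_lattice_bounded[OF f, of "real N"] N by auto
  obtain B where B: "\<And>t. cmod (f t) \<le> B" using S0_bounded[OF f] by blast
  define u where "u k = modulation (real N * of_int (snd k)) (translation (of_int (fst k)) f)" for k :: "int \<times> int"
  have [measurable]: "f \<in> borel_measurable borel" using S0D(3)[OF f] .
  have u_meas: "u k \<in> borel_measurable borel" for k
    unfolding u_def modulation_def translation_def by measurable
  have u_bound: "cmod (u k t) \<le> B" for k t
    using B by (simp add: u_def modulation_def translation_def norm_mult)
  have pair: "cmod (LINT t|lborel. tf_shift x \<xi> gauss t * u k t)
      = cmod (stft gauss f (x - of_int (fst k)) (- \<xi> - real N * of_int (snd k)))" for x \<xi> k
  proof -
    let ?a = "of_int (fst k) :: real" and ?b = "real N * of_int (snd k)"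
    have "(LINT t|lborel. tf_shift x \<xi> gauss t * u k t)
        = (LINT s|lborel. tf_shift x \<xi> gauss (?a + s) * u k (?a + s))"
      using lborel_integral_real_affine[of 1 _ ?a] by simp
    also have "\<dots> = (LINT s|lborel. cis (2 * pi * (\<xi> + ?b) * ?a) *
        (f s * gauss (s - (x - ?a)) * cis (- 2 * pi * (- \<xi> - ?b) * s)))"
    proof (intro Bochner_Integration.integral_cong refl)
      fix s :: real
      have phase: "cis (2 * pi * \<xi> * (?a + s)) * cis (2 * pi * ?b * (?a + s))
          = cis (2 * pi * (\<xi> + ?b) * ?a) * cis (- 2 * pi * (- \<xi> - ?b) * s)"
        by (simp add: cis_mult algebra_simps)
      have window: "gauss (?a + s - x) = gauss (s - (x - ?a))"
        by (rule arg_cong[where f = gauss]) simp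
      have "tf_shift x \<xi> gauss (?a + s) * u k (?a + s) =
         (cis (2 * pi * \<xi> * (?a + s)) * cis (2 * pi * ?b * (?a + s))) * (gauss (?a + s - x) * f s)"
        by (simp add: tf_shift_gauss u_def modulation_def translation_def)
      then show "tf_shift x \<xi> gauss (?a + s) * u k (?a + s) = cis (2 * pi * (\<xi> + ?b) * ?a) *
        (f s * gauss (s - (x - ?a)) * cis (- 2 * pi * (- \<xi> - ?b) * s))"
        unfolding phase window by (simp only: mult_ac)
    qed
    also have "\<dots> = cis (2 * pi * (\<xi> + ?b) * ?a) * stft gauss f (x - ?a) (- \<xi> - ?b)"
      unfolding stft_gauss by (rule integral_mult_right_zero)
    finally show ?thesis by (simp add: norm_mult)
  qed
  have "(\<Sum>k\<in>F. cmod (LINT t|lborel. u k t * h t)) \<le> sqrt 2 * C * S0_norm h"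
    if h: "h \<in> S0" and F: "finite F" for h F
    unfolding S0_norm_altdef
  proof (rule sum_integral_kernel_bound[OF F S0D(4)[OF h], where
      b = "\<lambda>k p. sqrt 2 * cmod (stft gauss f (fst p - of_int (fst k)) (- snd p - real N * of_int (snd k)))"])
    show "(\<lambda>p :: real \<times> real. sqrt 2 * cmod (stft gauss f (fst p - of_int (fst k)) (- snd p - real N * of_int (snd k))))
        \<in> borel_measurable lborel" for k
    proof -
      have "(\<lambda>p :: real \<times> real. stft gauss f (fst p - of_int (fst k)) (- snd p - real N * of_int (snd k))) \<in> borel_measurable lborel"
        by (rule stft_gauss_measurable[OF f]) measurable
      then show ?thesis by measurable
    qed
    show "(\<Sum>k\<in>F. sqrt 2 * cmod (stft gauss f (fst p - of_int (fst k)) (- snd p - real N * of_int (snd k)))) \<le> sqrt 2 * C" for p :: "real \<times> real"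
      using C[OF F, of "fst p" "- snd p"] by (simp add: sum_distrib_left[symmetric] case_prod_beta)
    fix k
    show "cmod (LINT t|lborel. u k t * h t) \<le> (LINT p|lborel. cmod (case p of (x, \<xi>) \<Rightarrow> stft gauss h x \<xi>) *
        (sqrt 2 * cmod (stft gauss f (fst p - of_int (fst k)) (- snd p - real N * of_int (snd k)))))"
      using norm_S0_pairing_le[OF h u_meas u_bound, of k] unfolding pair by (simp add: mult.commute)
  qed auto
  then show ?thesis by (auto simp: u_def lattice_pairing_def case_prod_beta)
qed

section \<open>Closure properties of the Feichtinger algebra\<close>

lemma L2_add:
  assumes f: "f \<in> L2" and g: "g \<in> L2"
  shows "(\<lambda>t. f t + g t) \<in> L2"
proof -
  have [measurable]: "f \<in> borel_measurable borel" "g \<in> borel_measurable borel"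
    using assms by (auto simp: L2_def)
  have "integrable lborel (\<lambda>t. (cmod (f t + g t))\<^sup>2)"
  proof (rule Bochner_Integration.integrable_bound)
    show "integrable lborel (\<lambda>t. 2 * (cmod (f t))\<^sup>2 + 2 * (cmod (g t))\<^sup>2)"
      using assms by (simp add: L2_def)
    show "AE t in lborel. norm ((cmod (f t + g t))\<^sup>2) \<le> norm (2 * (cmod (f t))\<^sup>2 + 2 * (cmod (g t))\<^sup>2)"
    proof (rule AE_I2)
      fix t
      have "(cmod (f t + g t))\<^sup>2 \<le> (cmod (f t) + cmod (g t))\<^sup>2"
        by (intro power_mono norm_triangle_ineq) simp
      also have "\<dots> \<le> 2 * (cmod (f t))\<^sup>2 + 2 * (cmod (g t))\<^sup>2"
        using sum_squares_bound[of "cmod (f t)" "cmod (g t)"] by (simp add: power2_sum)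
      finally show "norm ((cmod (f t + g t))\<^sup>2) \<le> norm (2 * (cmod (f t))\<^sup>2 + 2 * (cmod (g t))\<^sup>2)"
        by simp
    qed
  qed measurable
  then show ?thesis by (simp add: L2_def)
qed

text \<open>
  The limit of the double periodization is extensional, so its linearity also requires that sums and
  multiples of test functions are again test functions.
\<close>

lemma S0_add:
  assumes f: "f \<in> S0" and g: "g \<in> S0"
  shows "(\<lambda>t. f t + g t) \<in> S0"
proof -
  have mod_int: "integrable lborel (\<lambda>t. f t * gauss (t - x) * cis (- 2 * pi * \<xi> * t))" if "f \<in> S0" for f x \<xi>
  proof (rule Bochner_Integration.integrable_bound[OF L2_mult_gauss_integrable[OF S0D(1)[OF that], of x]])
    have [measurable]: "f \<in> borel_measurable borel" by (rule S0D(3)[OF that])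
    show "(\<lambda>t. f t * gauss (t - x) * cis (- 2 * pi * \<xi> * t)) \<in> borel_measurable lborel" by measurable
  qed (auto simp: norm_mult)
  have "stft gauss (\<lambda>t. f t + g t) x \<xi> = stft gauss f x \<xi> + stft gauss g x \<xi>" for x \<xi>
    unfolding stft_gauss distrib_right
    by (rule Bochner_Integration.integral_add) (intro mod_int f g)+
  moreover have "integrable lborel (\<lambda>p. (case p of (x, \<xi>) \<Rightarrow> stft gauss f x \<xi>) + (case p of (x, \<xi>) \<Rightarrow> stft gauss g x \<xi>))"
    using S0D(4)[OF f] S0D(4)[OF g] by (rule Bochner_Integration.integrable_add)
  ultimately have "integrable lborel (\<lambda>(x, \<xi>). stft gauss (\<lambda>t. f t + g t) x \<xi>)"
    by (simp add: case_prod_beta')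
  then show ?thesis
    using L2_add[OF S0D(1)[OF f] S0D(1)[OF g]] S0D(2)[OF f] S0D(2)[OF g]
    by (auto simp: S0_def intro: continuous_intros)
qed

lemma S0_scale:
  assumes f: "f \<in> S0"
  shows "(\<lambda>t. c * f t) \<in> S0"
proof -
  have "stft gauss (\<lambda>t. c * f t) x \<xi> = c * stft gauss f x \<xi>" for x \<xi>
    unfolding stft_gauss by (simp add: mult.assoc)
  moreover have "integrable lborel (\<lambda>p. c * (case p of (x, \<xi>) \<Rightarrow> stft gauss f x \<xi>))"
    using S0D(4)[OF f] by (rule integrable_mult_right)
  ultimately have "integrable lborel (\<lambda>(x, \<xi>). stft gauss (\<lambda>t. c * f t) x \<xi>)"
    by (simp add: case_prod_beta')
  moreover have "(\<lambda>t. c * f t) \<in> L2"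
    using S0D(1)[OF f] by (auto simp: L2_def norm_mult power_mult_distrib)
  ultimately show ?thesis
    using S0D(2)[OF f] by (auto simp: S0_def intro: continuous_intros)
qed

lemma integrable_reflect_translate:
  fixes V :: "real \<times> real \<Rightarrow> complex"
  assumes V: "integrable lborel V"
  shows "integrable lborel (\<lambda>p. V (fst p - a, - snd p - b))"
proof (rule integrableI_bounded)
  have [measurable]: "V \<in> borel_measurable borel" using V by auto
  show meas: "(\<lambda>p. V (fst p - a, - snd p - b)) \<in> borel_measurable lborel" by measurable
  have "(\<integral>\<^sup>+p. ennreal (cmod (V (fst p - a, - snd p - b))) \<partial>lborel)
      = (\<integral>\<^sup>+x. \<integral>\<^sup>+\<xi>. ennreal (cmod (V (x - a, - \<xi> - b))) \<partial>lborel \<partial>lborel)"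
    using lborel.nn_integral_fst[of "\<lambda>p. ennreal (cmod (V (fst p - a, - snd p - b)))" "lborel :: real measure"]
    by (simp add: lborel_prod)
  also have "\<dots> = (\<integral>\<^sup>+x. \<integral>\<^sup>+\<xi>. ennreal (cmod (V (x - a, \<xi>))) \<partial>lborel \<partial>lborel)"
  proof (rule nn_integral_cong)
    fix x :: real
    show "(\<integral>\<^sup>+\<xi>. ennreal (cmod (V (x - a, - \<xi> - b))) \<partial>lborel) = (\<integral>\<^sup>+\<xi>. ennreal (cmod (V (x - a, \<xi>))) \<partial>lborel)"
      using nn_integral_real_affine[of "\<lambda>\<xi>. ennreal (cmod (V (x - a, \<xi>)))" "-1" "- b"]
      by (simp add: algebra_simps)
  qed
  also have "\<dots> = (\<integral>\<^sup>+x. \<integral>\<^sup>+\<xi>. ennreal (cmod (V (x, \<xi>))) \<partial>lborel \<partial>lborel)"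
    using nn_integral_real_affine[of "\<lambda>x. \<integral>\<^sup>+\<xi>. ennreal (cmod (V (x, \<xi>))) \<partial>lborel" 1 "- a"]
    by simp
  also have "\<dots> = (\<integral>\<^sup>+p. ennreal (cmod (V p)) \<partial>lborel)"
    using lborel.nn_integral_fst[of "\<lambda>p. ennreal (cmod (V p))" "lborel :: real measure"]
    by (simp add: lborel_prod)
  also have "\<dots> < \<infinity>" using V by (simp add: integrable_iff_bounded)
  finally show "(\<integral>\<^sup>+p. ennreal (norm (V (fst p - a, - snd p - b))) \<partial>lborel) < \<infinity>" .
qed

text \<open>
  Up to a phase, the transform of the new function is the conjugate of the old transform after a
  reflection in frequency and a translation. This makes the conjugated window a legitimate test
  function for the double periodization.
\<close>

lemma S0_cnj_tf_shift:
  assumes g: "g \<in> S0"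
  shows "(\<lambda>t. cnj (tf_shift a b g t)) \<in> S0"
proof -
  have [measurable]: "g \<in> borel_measurable borel" by (rule S0D(3)[OF g])
  have stft_eq: "stft gauss (\<lambda>t. cnj (tf_shift a b g t)) x \<xi>
      = cis (- 2 * pi * (\<xi> + b) * a) * cnj (stft gauss g (x - a) (- \<xi> - b))" for x \<xi>
  proof -
    have "stft gauss (\<lambda>t. cnj (tf_shift a b g t)) x \<xi>
        = (LINT s|lborel. cnj (tf_shift a b g (a + s)) * gauss (a + s - x) * cis (- 2 * pi * \<xi> * (a + s)))"
      unfolding stft_gauss
      using lborel_integral_real_affine[of 1 "\<lambda>t. cnj (tf_shift a b g t) * gauss (t - x) * cis (- 2 * pi * \<xi> * t)" a] by simp
    also have "\<dots> = (LINT s|lborel. cis (- 2 * pi * (\<xi> + b) * a) *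
        cnj (g s * gauss (s - (x - a)) * cis (- 2 * pi * (- \<xi> - b) * s)))"
    proof (intro Bochner_Integration.integral_cong refl)
      fix s :: real
      have phase: "cnj (cis (2 * pi * b * (a + s))) * cis (- 2 * pi * \<xi> * (a + s))
          = cis (- 2 * pi * (\<xi> + b) * a) * cnj (cis (- 2 * pi * (- \<xi> - b) * s))"
        by (simp add: cis_cnj cis_mult algebra_simps)
      have window: "gauss (a + s - x) = gauss (s - (x - a))"
        by (rule arg_cong[where f = gauss]) simp
      have "cnj (tf_shift a b g (a + s)) = cnj (cis (2 * pi * b * (a + s))) * cnj (g s)"
        by (simp add: tf_shift_def modulation_def translation_def)
      then have "cnj (tf_shift a b g (a + s)) * gauss (a + s - x) * cis (- 2 * pi * \<xi> * (a + s))
          = (cnj (cis (2 * pi * b * (a + s))) * cis (- 2 * pi * \<xi> * (a + s))) * (cnj (g s) * gauss (s - (x - a)))"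
        by (simp only: window mult_ac)
      then show "cnj (tf_shift a b g (a + s)) * gauss (a + s - x) * cis (- 2 * pi * \<xi> * (a + s))
        = cis (- 2 * pi * (\<xi> + b) * a) * cnj (g s * gauss (s - (x - a)) * cis (- 2 * pi * (- \<xi> - b) * s))"
        unfolding phase complex_cnj_mult cnj_gauss by (simp only: mult_ac)
    qed
    also have "\<dots> = cis (- 2 * pi * (\<xi> + b) * a) * cnj (stft gauss g (x - a) (- \<xi> - b))"
      unfolding stft_gauss integral_mult_right_zero
      by (subst Bochner_Integration.integral_cnj) (rule refl)
    finally show ?thesis .
  qed
  have "integrable lborel (\<lambda>(x, \<xi>). stft gauss (\<lambda>t. cnj (tf_shift a b g t)) x \<xi>)"
    unfolding stft_eq
  proof (rule Bochner_Integration.integrable_bound)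
    show "integrable lborel (\<lambda>p. stft gauss g (fst p - a) (- snd p - b))"
      using integrable_reflect_translate[OF S0D(4)[OF g], of a b] by simp
    then show "(\<lambda>(x, \<xi>). cis (- 2 * pi * (\<xi> + b) * a) * cnj (stft gauss g (x - a) (- \<xi> - b))) \<in> borel_measurable lborel"
      unfolding case_prod_beta' by measurable
  qed (auto simp: norm_mult case_prod_beta)
  moreover have "(\<lambda>t. cnj (tf_shift a b g t)) \<in> L2"
  proof -
    have "integrable lborel (\<lambda>t. (cmod (g t))\<^sup>2)" using S0D(1)[OF g] by (simp add: L2_def)
    from lborel_integrable_real_affine[OF this, of 1 "- a"]
    show ?thesis
      unfolding L2_def by (auto simp: tf_shift_def modulation_def translation_def norm_mult)
  qed
  moreover have "continuous_on UNIV (\<lambda>t. cnj (tf_shift a b g t))"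
    unfolding tf_shift_def modulation_def translation_def
    by (intro continuous_intros continuous_on_compose2[OF S0D(2)[OF g]]) auto
  ultimately show ?thesis by (simp add: S0_def)
qed

section \<open>The double periodization as a distribution\<close>

lemma lattice_pairing_abs_summable:
  assumes f: "f \<in> S0" and h: "h \<in> S0" and N: "N \<ge> 1"
  shows "(\<lambda>k. cmod (case k of (k\<^sub>1, k\<^sub>2) \<Rightarrow> lattice_pairing N f h k\<^sub>1 k\<^sub>2)) summable_on UNIV"
proof -
  obtain C where C: "\<And>h F. h \<in> S0 \<Longrightarrow> finite F \<Longrightarrow>
    (\<Sum>k\<in>F. cmod (case k of (k\<^sub>1, k\<^sub>2) \<Rightarrow> lattice_pairing N f h k\<^sub>1 k\<^sub>2)) \<le> C * S0_norm h"
    using lattice_pairing_bounded[OF f N] by blast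
  show ?thesis
    by (rule nonneg_bdd_above_summable_on) (use C[OF h] in \<open>auto simp: bdd_above_def\<close>)
qed

lemma double_periodization_weak_star:
  assumes f: "f \<in> S0" and N: "N \<ge> 1"
  shows "weak_star_has_sum
        (\<lambda>(k\<^sub>1 :: int, k\<^sub>2 :: int).
           S0_embed (modulation (of_nat N * of_int k\<^sub>2) (translation (of_int k\<^sub>1) f)))
        (\<lambda>h\<in>S0. \<Sum>\<^sub>\<infinity>(k\<^sub>1, k\<^sub>2). lattice_pairing N f h k\<^sub>1 k\<^sub>2) UNIV"
  unfolding weak_star_has_sum_def
proof (intro conjI ballI)
  fix h assume h: "h \<in> S0"
  have "((\<lambda>(k\<^sub>1, k\<^sub>2). lattice_pairing N f h k\<^sub>1 k\<^sub>2) has_sum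
      (\<Sum>\<^sub>\<infinity>(k\<^sub>1, k\<^sub>2). lattice_pairing N f h k\<^sub>1 k\<^sub>2)) UNIV"
    by (rule has_sum_infsum[OF abs_summable_summable[OF lattice_pairing_abs_summable[OF f h N]]])
  moreover have "(case k of (k\<^sub>1, k\<^sub>2) \<Rightarrow>
      S0_embed (modulation (of_nat N * of_int k\<^sub>2) (translation (of_int k\<^sub>1) f))) h
      = (case k of (k\<^sub>1, k\<^sub>2) \<Rightarrow> lattice_pairing N f h k\<^sub>1 k\<^sub>2)" for k :: "int \<times> int"
    using h by (auto simp: S0_embed_def lattice_pairing_def split: prod.split)
  ultimately show "((\<lambda>k. (case k of (k\<^sub>1, k\<^sub>2) \<Rightarrow>
      S0_embed (modulation (of_nat N * of_int k\<^sub>2) (translation (of_int k\<^sub>1) f))) h) has_sum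
      (\<lambda>h\<in>S0. \<Sum>\<^sub>\<infinity>(k\<^sub>1, k\<^sub>2). lattice_pairing N f h k\<^sub>1 k\<^sub>2) h) UNIV"
    using h by simp
next
  let ?S = "\<lambda>h. \<Sum>\<^sub>\<infinity>(k\<^sub>1, k\<^sub>2). lattice_pairing N f h k\<^sub>1 k\<^sub>2"
  obtain B where B: "\<And>t. cmod (f t) \<le> B" using S0_bounded[OF f] by blast
  have [measurable]: "f \<in> borel_measurable borel" by (rule S0D(3)[OF f])
  have int: "integrable lborel (\<lambda>t. modulation (of_nat N * of_int k\<^sub>2) (translation (of_int k\<^sub>1) f) t * h t)"
    if h: "h \<in> S0" for h and k\<^sub>1 k\<^sub>2 :: int
  proof -
    have "integrable lborel (\<lambda>t. h t * modulation (of_nat N * of_int k\<^sub>2) (translation (of_int k\<^sub>1) f) t)"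
    proof (rule S0_mult_bounded_integrable[OF h, of _ B])
      show "modulation (of_nat N * of_int k\<^sub>2) (translation (of_int k\<^sub>1) f) \<in> borel_measurable borel"
        unfolding modulation_def translation_def by measurable
    qed (use B in \<open>simp add: modulation_def translation_def norm_mult\<close>)
    then show ?thesis by (simp add: mult.commute)
  qed
  have add: "?S (\<lambda>t. h\<^sub>1 t + h\<^sub>2 t) = ?S h\<^sub>1 + ?S h\<^sub>2" if h: "h\<^sub>1 \<in> S0" "h\<^sub>2 \<in> S0" for h\<^sub>1 h\<^sub>2
  proof -
    have "lattice_pairing N f (\<lambda>t. h\<^sub>1 t + h\<^sub>2 t) k\<^sub>1 k\<^sub>2
        = lattice_pairing N f h\<^sub>1 k\<^sub>1 k\<^sub>2 + lattice_pairing N f h\<^sub>2 k\<^sub>1 k\<^sub>2" for k\<^sub>1 k\<^sub>2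
      unfolding lattice_pairing_def distrib_left
      by (rule Bochner_Integration.integral_add) (intro int h)+
    then show ?thesis
      using infsum_add[OF abs_summable_summable[OF lattice_pairing_abs_summable[OF f h(1) N]]
          abs_summable_summable[OF lattice_pairing_abs_summable[OF f h(2) N]]]
      by (simp add: case_prod_beta')
  qed
  have scale: "?S (\<lambda>t. c * h t) = c * ?S h" for c h
  proof -
    have "lattice_pairing N f (\<lambda>t. c * h t) k\<^sub>1 k\<^sub>2 = c * lattice_pairing N f h k\<^sub>1 k\<^sub>2" for k\<^sub>1 k\<^sub>2
      unfolding lattice_pairing_def mult.left_commute[of _ c] by (rule integral_mult_right_zero)
    then show ?thesis
      by (simp add: case_prod_beta' infsum_cmult_right')
  qed
  obtain C where C: "\<And>h F. h \<in> S0 \<Longrightarrow> finite F \<Longrightarrow>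
    (\<Sum>k\<in>F. cmod (case k of (k\<^sub>1, k\<^sub>2) \<Rightarrow> lattice_pairing N f h k\<^sub>1 k\<^sub>2)) \<le> C * S0_norm h"
    using lattice_pairing_bounded[OF f N] by blast
  have bound: "cmod (?S h) \<le> C * S0_norm h" if h: "h \<in> S0" for h
  proof -
    have "cmod (?S h) \<le> (\<Sum>\<^sub>\<infinity>k. cmod (case k of (k\<^sub>1, k\<^sub>2) \<Rightarrow> lattice_pairing N f h k\<^sub>1 k\<^sub>2))"
      by (rule norm_infsum_bound[OF lattice_pairing_abs_summable[OF f h N]])
    also have "\<dots> \<le> C * S0_norm h"
      by (rule infsum_le_finite_sums[OF lattice_pairing_abs_summable[OF f h N]]) (rule C[OF h])
    finally show ?thesis .
  qed
  show "(\<lambda>h\<in>S0. ?S h) \<in> S0_dual"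
    unfolding S0_dual_def mem_Collect_eq
  proof (intro conjI ballI allI exI)
    show "(\<lambda>h\<in>S0. ?S h) \<in> extensional S0" by simp
    show "(\<lambda>h\<in>S0. ?S h) (\<lambda>t. h\<^sub>1 t + h\<^sub>2 t) = (\<lambda>h\<in>S0. ?S h) h\<^sub>1 + (\<lambda>h\<in>S0. ?S h) h\<^sub>2"
      if "h\<^sub>1 \<in> S0" "h\<^sub>2 \<in> S0" for h\<^sub>1 h\<^sub>2
      using add[OF that] S0_add[OF that] that by simp
    show "(\<lambda>h\<in>S0. ?S h) (\<lambda>t. c * h t) = c * (\<lambda>h\<in>S0. ?S h) h" if "h \<in> S0" for c h
      using scale S0_scale[OF that] that by simp
    show "cmod ((\<lambda>h\<in>S0. ?S h) h) \<le> C * S0_norm h" if "h \<in> S0" for h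
      using bound[OF that] that by simp
  qed
qed

lemma double_periodization_eq:
  assumes "f \<in> S0" "N \<ge> 1" "h \<in> S0"
  shows "double_periodization N f h = (\<Sum>\<^sub>\<infinity>(k\<^sub>1, k\<^sub>2). lattice_pairing N f h k\<^sub>1 k\<^sub>2)"
proof -
  note ws = double_periodization_weak_star[OF assms(1,2)]
  have "double_periodization N f = (\<lambda>h\<in>S0. \<Sum>\<^sub>\<infinity>(k\<^sub>1, k\<^sub>2). lattice_pairing N f h k\<^sub>1 k\<^sub>2)"
    unfolding double_periodization_def
    by (rule the_equality) (rule ws, rule weak_star_has_sum_unique[OF _ ws])
  then show ?thesis using assms(3) by simp
qed

section \<open>Sampling and reduction modulo N\<close>

text \<open>
  Poisson summation for \<open>F t = f (t / N - k\<^sub>1) * h (t / N)\<close>, where the dilation by \<open>N\<close> turns frequencies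
  \<open>N * k\<^sub>2\<close> into integers.
\<close>

lemma lattice_pairing_modulation_sum:
  assumes f: "f \<in> S0" and h: "h \<in> S0" and N: "N \<ge> 1"
  shows "(\<Sum>\<^sub>\<infinity>k\<^sub>2. lattice_pairing N f h k\<^sub>1 k\<^sub>2)
    = 1 / of_nat N * (\<Sum>\<^sub>\<infinity>n. f (of_int n / of_nat N - of_int k\<^sub>1) * h (of_int n / of_nat N))"
proof -
  define F where "F t = f (t / real N - of_int k\<^sub>1) * h (t / real N)" for t
  have N0: "real N > 0" using N by simp
  obtain B where B: "\<And>t. cmod (f t) \<le> B" using S0_bounded[OF f] by blast
  have B0: "B \<ge> 0" using order_trans[OF norm_ge_zero B] .
  obtain M where M: "M summable_on UNIV" and hM: "\<And>n t. \<bar>t\<bar> \<le> 1/2 \<Longrightarrow> cmod (h (1 / real N * (of_int n + t))) \<le> M n"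
    using S0_wiener_amalgam[OF h, of "1 / real N"] N0 by auto
  have coeff: "(LINT t|lborel. F t * cis (2 * pi * of_int k * t)) = of_nat N * lattice_pairing N f h k\<^sub>1 k" for k
  proof -
    have "(LINT t|lborel. F t * cis (2 * pi * of_int k * t))
        = real N *\<^sub>R (LINT s|lborel. F (real N * s) * cis (2 * pi * of_int k * (real N * s)))"
      using lborel_integral_real_affine[of "real N" "\<lambda>t. F t * cis (2 * pi * of_int k * t)" 0] N0 by simp
    also have "(LINT s|lborel. F (real N * s) * cis (2 * pi * of_int k * (real N * s))) = lattice_pairing N f h k\<^sub>1 k"
      unfolding lattice_pairing_def F_def
      using N0 by (intro Bochner_Integration.integral_cong refl)
        (simp add: modulation_def translation_def mult_ac)
    finally show ?thesis by (simp add: scaleR_conv_of_real)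
  qed
  have summable: "(\<lambda>k. lattice_pairing N f h k\<^sub>1 k) summable_on UNIV"
    using summable_on_SigmaD1[of "lattice_pairing N f h" UNIV "\<lambda>_. UNIV" k\<^sub>1]
      abs_summable_summable[OF lattice_pairing_abs_summable[OF f h N]] by simp
  have "((\<lambda>k::int. LINT t|lborel. F t * cis (2 * pi * of_int k * t)) has_sum (\<Sum>\<^sub>\<infinity>n. F (of_int n))) UNIV"
  proof (rule poisson_summation[where M = "\<lambda>n. B * M n"])
    show "continuous_on UNIV F"
      unfolding F_def using N0
      by (intro continuous_intros continuous_on_compose2[OF S0D(2)[OF f]] continuous_on_compose2[OF S0D(2)[OF h]]) auto
    have "integrable lborel (\<lambda>t. h t * f (t - of_int k\<^sub>1))"
    proof (rule S0_mult_bounded_integrable[OF h, of _ B])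
      have [measurable]: "f \<in> borel_measurable borel" by (rule S0D(3)[OF f])
      show "(\<lambda>t. f (t - of_int k\<^sub>1)) \<in> borel_measurable borel" by measurable
    qed (rule B)
    from lborel_integrable_real_affine[OF this, of "1 / real N" 0] N0
    show "integrable lborel F"
      by (simp add: F_def[abs_def] mult.commute)
    show "(\<lambda>n. B * M n) summable_on UNIV" using M by (rule summable_on_cmult_right)
    show "cmod (F (of_int n + t)) \<le> B * M n" if "\<bar>t\<bar> \<le> 1/2" for n t
      using hM[OF that, of n] B B0 by (auto simp: F_def norm_mult intro!: mult_mono)
    show "(\<lambda>k::int. LINT t|lborel. F t * cis (2 * pi * of_int k * t)) summable_on UNIV"
      unfolding coeff using summable by (rule summable_on_cmult_right)
  qed
  then have "(\<Sum>\<^sub>\<infinity>k. of_nat N * lattice_pairing N f h k\<^sub>1 k) = (\<Sum>\<^sub>\<infinity>n. F (of_int n))"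
    unfolding coeff by (rule infsumI)
  then have "of_nat N * (\<Sum>\<^sub>\<infinity>k. lattice_pairing N f h k\<^sub>1 k) = (\<Sum>\<^sub>\<infinity>n. F (of_int n))"
    by (simp add: infsum_cmult_right')
  then show ?thesis using N by (simp add: F_def field_simps)
qed

text \<open>
  Allows the sums over sampling points and over translates to be exchanged. The translates of \<open>f\<close> are
  summable uniformly in the sampling point, and the samples of \<open>h\<close> are summable.
\<close>

lemma sampled_products_summable:
  assumes f: "f \<in> S0" and h: "h \<in> S0" and N: "N \<ge> 1"
  shows "(\<lambda>(n :: int, j :: int). f (of_int n / of_nat N - of_int j) * h (of_int n / of_nat N)) summable_on UNIV \<times> UNIV"
proof -
  obtain C where C: "\<And>t F. finite F \<Longrightarrow> (\<Sum>k\<in>F. cmod (f (t - of_int k))) \<le> C"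
    using S0_translates_bounded[OF f] by blast
  have C0: "C \<ge> 0" using C[of "{}"] by simp
  obtain M where M: "M summable_on UNIV" and hM': "\<And>n t. \<bar>t\<bar> \<le> 1/2 \<Longrightarrow> cmod (h (1 / real N * (of_int n + t))) \<le> M n"
    using S0_wiener_amalgam[OF h, of "1 / real N"] N by auto
  have hM: "cmod (h (of_int n / real N)) \<le> M n" for n using hM'[of 0 n] by simp
  have M0: "M n \<ge> 0" for n using order_trans[OF norm_ge_zero hM] .
  let ?q = "\<lambda>n j. f (of_int n / real N - of_int j) * h (of_int n / real N)"
  have "(\<Sum>p\<in>F. cmod (?q (fst p) (snd p))) \<le> C * infsum M UNIV" if F: "finite F" for F :: "(int \<times> int) set"
  proof -
    have "(\<Sum>p\<in>F. cmod (?q (fst p) (snd p))) \<le> (\<Sum>p\<in>fst ` F \<times> snd ` F. cmod (?q (fst p) (snd p)))"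
      using F by (intro sum_mono2) force+
    also have "\<dots> = (\<Sum>n\<in>fst ` F. (\<Sum>j\<in>snd ` F. cmod (f (of_int n / real N - of_int j))) * cmod (h (of_int n / real N)))"
      by (simp add: sum.cartesian_product' case_prod_beta' norm_mult sum_distrib_right)
    also have "\<dots> \<le> (\<Sum>n\<in>fst ` F. C * M n)"
      using F C0 by (intro sum_mono mult_mono C hM) auto
    also have "\<dots> = C * (\<Sum>n\<in>fst ` F. M n)" by (simp add: sum_distrib_left)
    also have "\<dots> \<le> C * infsum M UNIV"
      using F C0 M0 M by (intro mult_left_mono finite_sum_le_infsum) auto
    finally show ?thesis .
  qed
  then have "(\<lambda>p. cmod (?q (fst p) (snd p))) summable_on UNIV"
    by (intro nonneg_bdd_above_summable_on) (auto simp: bdd_above_def)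
  then have "(\<lambda>p. ?q (fst p) (snd p)) summable_on UNIV"
    by (rule abs_summable_summable)
  then show ?thesis by (simp add: case_prod_beta')
qed

definition periodization :: "(real \<Rightarrow> complex) \<Rightarrow> real \<Rightarrow> complex" where
  "periodization f t = (\<Sum>\<^sub>\<infinity>j\<in>(UNIV :: int set). f (t - of_int j))"

lemma periodization_add_int: "periodization f (t + of_int i) = periodization f t"
  unfolding periodization_def
  by (rule infsum_reindex_bij_witness[of _ "\<lambda>j. j + i" "\<lambda>j. j - i"]) (auto simp: algebra_simps)

lemma periodization_altdef: "periodization f t = (\<Sum>\<^sub>\<infinity>j\<in>(UNIV :: int set). f (t + of_int j))"
  unfolding periodization_def
  by (rule infsum_reindex_bij_witness[of _ uminus uminus]) auto

lemma sampled_periodization_eq: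
  "n < N \<Longrightarrow> sampled_periodization N f n = periodization f (real n / real N)"
  by (simp add: sampled_periodization_def periodization_def)

lemma infsum_int_residues:
  fixes q :: "int \<Rightarrow> 'a :: banach"
  assumes N: "N \<ge> (1 :: nat)" and q: "q summable_on UNIV"
  shows "infsum q UNIV = (\<Sum>m<N. \<Sum>\<^sub>\<infinity>j. q (int m + int N * j))"
proof -
  have bij: "bij_betw (\<lambda>(m, j). int m + int N * j) ({..<N} \<times> UNIV) UNIV"
    by (rule bij_betw_byWitness[where f' = "\<lambda>n. (nat (n mod int N), n div int N)"])
       (use N in \<open>auto simp: nat_less_iff\<close>)
  have "infsum q UNIV = (\<Sum>\<^sub>\<infinity>p\<in>{..<N} \<times> UNIV. q (case p of (m, j) \<Rightarrow> int m + int N * j))"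
    by (rule infsum_reindex_bij_betw[OF bij, symmetric])
  also have "\<dots> = (\<Sum>\<^sub>\<infinity>(m, j)\<in>{..<N} \<times> UNIV. q (int m + int N * j))"
    by (simp add: case_prod_beta')
  also have "\<dots> = (\<Sum>\<^sub>\<infinity>m\<in>{..<N}. \<Sum>\<^sub>\<infinity>j. q (int m + int N * j))"
  proof (rule infsum_Sigma'_banach[symmetric])
    have "(\<lambda>p. q (case p of (m, j) \<Rightarrow> int m + int N * j)) summable_on {..<N} \<times> UNIV"
      using summable_on_reindex_bij_betw[OF bij] q by blast
    then show "(\<lambda>(m, j). q (int m + int N * j)) summable_on {..<N} \<times> UNIV"
      by (simp add: case_prod_beta')
  qed
  finally show ?thesis by simp
qed

text \<open>
  Summing over \<open>k\<^sub>1\<close> turns the translates of \<open>f\<close> into its periodization at \<open>n / N\<close>, which depends only on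
  \<open>n mod N\<close>. Collecting the samples of \<open>h\<close> in one residue class therefore periodizes \<open>h\<close> as well.
\<close>

lemma double_periodization_sampling:
  assumes f: "f \<in> S0" and h: "h \<in> S0" and N: "N \<ge> 1"
  shows "double_periodization N f h
    = 1 / of_nat N * (\<Sum>m<N. periodization f (real m / real N) * periodization h (real m / real N))"
proof -
  let ?q = "\<lambda>(n :: int) (j :: int). f (of_int n / real N - of_int j) * h (of_int n / real N)"
  have q: "(\<lambda>(n, j). ?q n j) summable_on UNIV \<times> UNIV"
    by (rule sampled_products_summable[OF f h N])
  define r where "r n = periodization f (of_int n / real N) * h (of_int n / real N)" for n :: int
  have r: "(\<Sum>\<^sub>\<infinity>j. ?q n j) = r n" for n
    by (simp add: r_def periodization_def infsum_cmult_left')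
  have "(\<lambda>n. \<Sum>\<^sub>\<infinity>j. ?q n j) summable_on UNIV"
    by (rule summable_on_Sigma_banach[OF q])
  then have r_summable: "r summable_on UNIV" unfolding r .
  have "double_periodization N f h = (\<Sum>\<^sub>\<infinity>j. \<Sum>\<^sub>\<infinity>k. lattice_pairing N f h j k)"
    unfolding double_periodization_eq[OF f N h]
    using abs_summable_summable[OF lattice_pairing_abs_summable[OF f h N]]
    by (subst infsum_Sigma'_banach) auto
  also have "\<dots> = 1 / of_nat N * (\<Sum>\<^sub>\<infinity>j. \<Sum>\<^sub>\<infinity>n. ?q n j)"
    unfolding lattice_pairing_modulation_sum[OF f h N] by (rule infsum_cmult_right')
  also have "(\<Sum>\<^sub>\<infinity>j. \<Sum>\<^sub>\<infinity>n. ?q n j) = (\<Sum>\<^sub>\<infinity>n. \<Sum>\<^sub>\<infinity>j. ?q n j)"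
    by (rule infsum_swap_banach[OF q, symmetric])
  also have "\<dots> = (\<Sum>m<N. \<Sum>\<^sub>\<infinity>j. r (int m + int N * j))"
    unfolding r by (rule infsum_int_residues[OF N r_summable])
  also have "\<dots> = (\<Sum>m<N. periodization f (real m / real N) * periodization h (real m / real N))"
  proof (rule sum.cong[OF refl])
    fix m
    have arg: "of_int (int m + int N * j) / real N = real m / real N + of_int j" for j
      using N by (simp add: field_simps)
    show "(\<Sum>\<^sub>\<infinity>j. r (int m + int N * j)) = periodization f (real m / real N) * periodization h (real m / real N)"
      unfolding r_def arg periodization_add_int periodization_altdef[of h] by (rule infsum_cmult_right')
  qed
  finally show ?thesis .
qed

text \<open>
  An integer frequency gives a 1-periodic character, which passes through the periodization. This is
  where the frequency variable has to be an integer.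
\<close>

lemma periodization_cnj_tf_shift:
  "periodization (\<lambda>t. cnj (tf_shift x (real l) g t)) t
    = cnj (cis (2 * pi * real l * t)) * cnj (periodization g (t - x))"
proof -
  have "cnj (tf_shift x (real l) g (t - of_int j)) = cnj (cis (2 * pi * real l * t)) * cnj (g (t - x - of_int j))" for j
  proof -
    have "cis (2 * pi * real l * (t - of_int j)) = cis (2 * pi * real l * t) * cis (2 * pi * of_int (- int l * j))"
      by (simp add: cis_mult algebra_simps)
    also have "cis (2 * pi * of_int (- int l * j)) = 1" by (rule cis_multiple_2pi) simp
    finally show ?thesis
      by (simp add: tf_shift_def modulation_def translation_def algebra_simps)
  qed
  then show ?thesis
    by (simp add: periodization_def infsum_cmult_right')
qed

theorem theorem1:
  fixes N k l :: nat and f g :: "real \<Rightarrow> complex"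
  assumes "N \<ge> 1"
    and "f \<in> S0" and "g \<in> S0"
    and "k < N" and "l < N"
  shows "stft_dual g (double_periodization N f) (real k / real N) (real l)
       = 1 / of_nat N *
         discrete_gabor N (sampled_periodization N g) (sampled_periodization N f) k l"
proof -
  note N = assms(1) and f = assms(2) and g = assms(3)
  have "stft_dual g (double_periodization N f) (real k / real N) (real l)
      = double_periodization N f (\<lambda>t. cnj (tf_shift (real k / real N) (real l) g t))"
    by (simp add: stft_dual_def pairing_def)
  also have "\<dots> = 1 / of_nat N * (\<Sum>m<N. periodization f (real m / real N) *
      periodization (\<lambda>t. cnj (tf_shift (real k / real N) (real l) g t)) (real m / real N))"
    by (rule double_periodization_sampling[OF f S0_cnj_tf_shift[OF g] N])
  also have "(\<Sum>m<N. periodization f (real m / real N) *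
      periodization (\<lambda>t. cnj (tf_shift (real k / real N) (real l) g t)) (real m / real N))
      = discrete_gabor N (sampled_periodization N g) (sampled_periodization N f) k l"
    unfolding discrete_gabor_def
  proof (rule sum.cong[OF refl])
    fix m assume m: "m \<in> {..<N}"
    define i where "i = (int m - int k) mod int N"
    have i: "0 \<le> i" "i < int N" using N by (auto simp: i_def)
    have "int m - int k = i + int N * ((int m - int k) div int N)" by (simp add: i_def)
    then have "real_of_int (int m - int k) = of_int (i + int N * ((int m - int k) div int N))" by simp
    then have "real m / real N - real k / real N = real (nat i) / real N + of_int ((int m - int k) div int N)"
      using N i by (simp add: field_simps)
    then have "periodization g (real m / real N - real k / real N) = sampled_periodization N g (nat i)"
      using i by (simp add: sampled_periodization_eq periodization_add_int)
    moreover have "cnj (cis (2 * pi * real l * (real m / real N))) = cis (- 2 * pi * real l * real m / real N)"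
      by (simp add: cis_cnj)
    ultimately show "periodization f (real m / real N) *
      periodization (\<lambda>t. cnj (tf_shift (real k / real N) (real l) g t)) (real m / real N)
      = sampled_periodization N f m * cnj (sampled_periodization N g (nat ((int m - int k) mod int N)))
              * cis (- 2 * pi * real l * real m / real N)"
      using m by (simp add: periodization_cnj_tf_shift sampled_periodization_eq i_def)
  qed
  finally show ?thesis .
qed

end
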